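(* If $S$ is a finite non-abelian subset of $BS^{+}(1,2)$ of size $|S|=k$, then $$|S^2|\ge 3k-2.$$ Moreover, if $$|S^2|=(3k-2)+h<3.5k-4,$$ then there exists a finite set of integers $A\subseteq\mathbb{Z}$ such that (a) $S=ba^A$; (b) the set $A$ is contained in an arithmetic progression of size $k+h<1.5k-2$.
   Context: $BS(1,2)=\langle a,b\mid ab=ba^2\rangle$ is the Baumslag-Solitar group, and $BS^{+}(1,2)=\{b^ma^x\in BS(1,2): m,x\in\mathbb{Z},\ m\ge 0\}$, a submonoid of $BS(1,2)$. A subset $S$ of a group is called non-abelian if the subgroup $\langle S\rangle$ it generates is non-abelian. $S^2=\{s_1s_2: s_1,s_2\in S\}$. For finite $A\subseteq\mathbb{Z}$, $ba^A=\{ba^x: x\in A\}$. $|X|$ denotes the size of a finite set $X$. *)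

theory Defs
  imports Complex_Main "HOL-Algebra.Elementary_Groups"
begin

section \<open>Groups given by generators and relations\<close>

text \<open>
  A group word over generators of type \<open>'g\<close> is a list of signed letters: \<open>(g, True)\<close> stands for
  the generator \<open>g\<close> and \<open>(g, False)\<close> for its formal inverse.
\<close>

type_synonym 'g word = "('g \<times> bool) list"

text \<open>
  A presentation is a set of pairs \<open>(u, v)\<close> of words, each read as a defining relation \<open>u = v\<close>.
  The relation below is the least congruence on words that contains the defining relations and
  lets adjacent mutually inverse letters cancel.
\<close>

inductive pres_eq :: "('g word \<times> 'g word) set \<Rightarrow> 'g word \<Rightarrow> 'g word \<Rightarrow> bool"
  for R :: "('g word \<times> 'g word) set" where
  refl: "pres_eq R u u"
| sym: "pres_eq R u v \<Longrightarrow> pres_eq R v u"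
| trans: "pres_eq R u v \<Longrightarrow> pres_eq R v w \<Longrightarrow> pres_eq R u w"
| cong: "pres_eq R u u' \<Longrightarrow> pres_eq R v v' \<Longrightarrow> pres_eq R (u @ v) (u' @ v')"
| cancel: "pres_eq R [(g, e), (g, \<not> e)] []"
| rel: "(u, v) \<in> R \<Longrightarrow> pres_eq R u v"

definition pres_class :: "('g word \<times> 'g word) set \<Rightarrow> 'g word \<Rightarrow> 'g word set" where
  "pres_class R u = {v. pres_eq R u v}"

definition presented_group :: "('g word \<times> 'g word) set \<Rightarrow> 'g word set monoid" where
  "presented_group R =
    \<lparr>carrier = range (pres_class R),
     mult = (\<lambda>X Y. \<Union>u\<in>X. \<Union>v\<in>Y. pres_class R (u @ v)),
     one = pres_class R []\<rparr>"

lemma pres_class_eq_iff: "pres_class R u = pres_class R v \<longleftrightarrow> pres_eq R u v"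
proof
  assume "pres_class R u = pres_class R v"
  then have "v \<in> pres_class R u"
    by (simp add: pres_class_def pres_eq.refl)
  then show "pres_eq R u v"
    by (simp add: pres_class_def)
next
  assume "pres_eq R u v"
  then have "pres_eq R u w \<longleftrightarrow> pres_eq R v w" for w
    using pres_eq.trans[of R u v w] pres_eq.trans[of R v u w] pres_eq.sym[of R u v] by argo
  then show "pres_class R u = pres_class R v"
    by (simp add: pres_class_def)
qed

lemma carrier_presented_group: "carrier (presented_group R) = range (pres_class R)"
  by (simp add: presented_group_def)

lemma one_presented_group: "\<one>\<^bsub>presented_group R\<^esub> = pres_class R []"
  by (simp add: presented_group_def)

lemma mult_presented_group:
  "pres_class R u \<otimes>\<^bsub>presented_group R\<^esub> pres_class R v = pres_class R (u @ v)"
proof -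
  have "(\<Union>u'\<in>pres_class R u. \<Union>v'\<in>pres_class R v. pres_class R (u' @ v')) =
      (\<Union>u'\<in>pres_class R u. \<Union>v'\<in>pres_class R v. pres_class R (u @ v))"
  proof (intro SUP_cong HOL.refl)
    fix u' v' assume "u' \<in> pres_class R u" "v' \<in> pres_class R v"
    then have "pres_eq R (u @ v) (u' @ v')"
      unfolding pres_class_def mem_Collect_eq by (rule pres_eq.cong)
    then show "pres_class R (u' @ v') = pres_class R (u @ v)"
      unfolding pres_class_eq_iff by (rule pres_eq.sym)
  qed
  moreover have "pres_class R u \<noteq> {}" "pres_class R v \<noteq> {}"
    using pres_eq.refl[of R u] pres_eq.refl[of R v] by (auto simp only: pres_class_def)
  ultimately show ?thesis
    by (simp add: presented_group_def)
qed

lemma group_presented_group: "group (presented_group R)"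
proof (rule groupI)
  fix X assume "X \<in> carrier (presented_group R)"
  then obtain u where X: "X = pres_class R u"
    by (auto simp: carrier_presented_group)
  have "\<exists>v. pres_eq R (v @ u) []"
  proof (induction u)
    case Nil
    have "pres_eq R ([] @ []) []" by (simp add: pres_eq.refl)
    then show ?case by blast
  next
    case (Cons x u)
    obtain g e where x: "x = (g, e)" by (cases x)
    from Cons obtain v where v: "pres_eq R (v @ u) []" by blast
    have "pres_eq R [(g, \<not> e), x] []"
      using pres_eq.cancel[of R g "\<not> e"] by (simp add: x)
    then have "pres_eq R (v @ [(g, \<not> e), x] @ u) (v @ [] @ u)"
      by (rule pres_eq.cong[OF pres_eq.refl pres_eq.cong[OF _ pres_eq.refl]])
    then have "pres_eq R ((v @ [(g, \<not> e)]) @ x # u) []"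
      using pres_eq.trans[OF _ v] by simp
    then show ?case by blast
  qed
  then obtain v where "pres_eq R (v @ u) []" by blast
  then show "\<exists>Y\<in>carrier (presented_group R).
      Y \<otimes>\<^bsub>presented_group R\<^esub> X = \<one>\<^bsub>presented_group R\<^esub>"
    by (intro bexI[of _ "pres_class R v"])
      (auto simp: X mult_presented_group one_presented_group carrier_presented_group pres_class_eq_iff)
qed (auto simp: carrier_presented_group mult_presented_group one_presented_group)


section \<open>The Baumslag--Solitar group BS(1,2)\<close>

datatype bs_gen = GenA | GenB

definition bs_rels :: "(bs_gen word \<times> bs_gen word) set" where
  "bs_rels = {([(GenA, True), (GenB, True)], [(GenB, True), (GenA, True), (GenA, True)])}"

definition BS12 :: "bs_gen word set monoid" where
  "BS12 = presented_group bs_rels"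

definition bs_a :: "bs_gen word set" where
  "bs_a = pres_class bs_rels [(GenA, True)]"

definition bs_b :: "bs_gen word set" where
  "bs_b = pres_class bs_rels [(GenB, True)]"

lemma group_BS12: "group BS12"
  by (simp add: BS12_def group_presented_group)

lemma BS12_generators: "bs_a \<in> carrier BS12" "bs_b \<in> carrier BS12"
  by (simp_all add: BS12_def bs_a_def bs_b_def carrier_presented_group)

lemma BS12_relation: "bs_a \<otimes>\<^bsub>BS12\<^esub> bs_b = bs_b \<otimes>\<^bsub>BS12\<^esub> bs_a [^]\<^bsub>BS12\<^esub> (2::nat)"
proof -
  interpret group BS12 by (rule group_BS12)
  have "bs_a [^]\<^bsub>BS12\<^esub> (2::nat) = bs_a \<otimes>\<^bsub>BS12\<^esub> bs_a"
    by (simp add: numeral_2_eq_2 BS12_generators)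
  then show ?thesis
    by (simp add: BS12_def bs_a_def bs_b_def mult_presented_group pres_class_eq_iff pres_eq.rel bs_rels_def)
qed

definition BS12_plus :: "bs_gen word set set" where
  "BS12_plus = {bs_b [^]\<^bsub>BS12\<^esub> m \<otimes>\<^bsub>BS12\<^esub> bs_a [^]\<^bsub>BS12\<^esub> x | (m::int) (x::int). m \<ge> 0}"

definition ba_set :: "int set \<Rightarrow> bs_gen word set set" where
  "ba_set A = {bs_b \<otimes>\<^bsub>BS12\<^esub> bs_a [^]\<^bsub>BS12\<^esub> x | x. x \<in> A}"


section \<open>Non-abelian subsets and arithmetic progressions\<close>

definition non_abelian_subset :: "('a, 'b) monoid_scheme \<Rightarrow> 'a set \<Rightarrow> bool" where
  "non_abelian_subset G S \<longleftrightarrow> S \<subseteq> carrier G \<and> \<not> comm_group (subgroup_generated G S)"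

text \<open>The difference is nonzero, so that the progression has exactly \<open>n\<close> elements.\<close>

definition arith_progression :: "int set \<Rightarrow> nat \<Rightarrow> bool" where
  "arith_progression P n \<longleftrightarrow> (\<exists>u d. d \<noteq> 0 \<and> P = (\<lambda>i. u + d * int i) ` {..<n})"

lemma card_arith_progression: "arith_progression P n \<Longrightarrow> card P = n"
  by (auto simp: arith_progression_def card_image inj_on_def)

end

theory Submission
  imports Defs "HOL-Library.Set_Algebras"
begin

text \<open>
  Writing \<open>b\<^sup>m a\<^sup>x\<close> as the pair \<open>(m, x)\<close>, the product in the submonoid is
  \<open>(m, x) (n, y) = (m + n, 2\<^sup>n x + y)\<close>, so a product of two levels is a sum \<open>2\<^sup>n A + B\<close> of integer sets.

  If \<open>S\<close> lies on one level \<open>m\<close>, the question concerns \<open>A + rA\<close> with \<open>r = 2\<^sup>m\<close>. Normalise \<open>A\<close> to have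
  minimum 0, maximum \<open>l\<close> and gcd 1. At least two residue classes mod \<open>r\<close> are met, and each class
  \<open>X\<close> has \<open>|X + rA| \<ge> |A| + |X| - 1\<close>. Write \<open>X = u + rB\<close>, so that \<open>|X + rA| = |A + B|\<close>.
  Reducing mod \<open>l\<close> and applying Olson's bound \<open>|Y + B| \<ge> |Y| + |B|/2\<close>,
  one gains a further \<open>(|X| - 1)/2\<close> in every class unless the sum fills all residues, in which
  case \<open>l\<close> is bounded in terms of \<open>|A + rA|\<close>.

  If \<open>S\<close> meets at least two levels, \<open>|S\<^sup>2| \<ge> 7k/2 - 4\<close> follows by removing the top level. The squares
  and products of the two top levels are new; if both levels are singletons, further new products
  come from an element not commuting with the top one, since the centralizer of an element of
  positive level meets every level at most once.
\<close>

section \<open>Olson's bound in finite abelian groups\<close>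

lemma (in group) subset_set_mult_one:
  assumes "finite (carrier G)" "X \<subseteq> carrier G" "B \<subseteq> carrier G" "\<one> \<in> B"
  shows "X \<subseteq> X <#> B"
proof
  fix x assume "x \<in> X"
  then show "x \<in> X <#> B" using assms unfolding set_mult_def by force
qed

text \<open>
  Among the sets \<open>X\<close> with \<open>X <#> B\<close> not the whole group take one minimising first \<open>|X <#> B| - |X|\<close> and
  then \<open>|X|\<close>. By submodularity two distinct translates of it are disjoint, so the translate
  containing the identity is a subgroup \<open>H\<close>, and \<open>H <#> B\<close> contains at least two cosets of \<open>H\<close>.
\<close>

lemma (in comm_group) card_set_mult_generating:
  assumes fin: "finite (carrier G)" and B: "B \<subseteq> carrier G" and one: "\<one> \<in> B"
    and gen: "\<And>H. subgroup H G \<Longrightarrow> B \<subseteq> H \<Longrightarrow> H = carrier G"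
    and X0: "X0 \<subseteq> carrier G" "X0 \<noteq> {}"
  shows "X0 <#> B = carrier G \<or> 2 * card X0 + card B \<le> 2 * card (X0 <#> B)"
proof (cases "X0 <#> B = carrier G")
  case False
  define F where "F X \<longleftrightarrow> X \<subseteq> carrier G \<and> X \<noteq> {} \<and> X <#> B \<noteq> carrier G" for X
  \<comment> \<open>Natural subtraction is faithful on subsets of the group: the identity lies in
    \<open>B\<close>, so fact \<open>le\<close> excludes truncation.\<close>
  define \<delta> where "\<delta> X = card (X <#> B) - card X" for X
  have sub: "X <#> B \<subseteq> carrier G" if "X \<subseteq> carrier G" for X
    using that B by (rule set_mult_closed)
  have finS: "finite X" "finite (X <#> B)" if "X \<subseteq> carrier G" for X
    using that sub[OF that] fin finite_subset by blast+
  have le: "card X \<le> card (X <#> B)" if "X \<subseteq> carrier G" for X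
    using subset_set_mult_one[OF fin that B one] finS[OF that] card_mono by blast
  have "F X0" using X0 False by (simp add: F_def)
  then obtain X1 where X1: "F X1" "\<And>Y. F Y \<Longrightarrow> \<delta> X1 \<le> \<delta> Y"
    using ex_has_least_nat[of F X0 \<delta>] by blast
  define \<kappa> where "\<kappa> = \<delta> X1"
  have "F X1 \<and> \<delta> X1 = \<kappa>" using X1 by (simp add: \<kappa>_def)
  then obtain X2 where X2: "F X2" "\<delta> X2 = \<kappa>"
    and X2min: "\<And>Y. F Y \<Longrightarrow> \<delta> Y = \<kappa> \<Longrightarrow> card X2 \<le> card Y"
    using ex_has_least_nat[of "\<lambda>X. F X \<and> \<delta> X = \<kappa>" X1 card] by blast
  define \<alpha> where "\<alpha> = card X2"
  have kle: "card Y + \<kappa> \<le> card (Y <#> B)" if "F Y" for Y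
    using X1(2)[OF that] le[of Y] that by (auto simp: \<kappa>_def \<delta>_def F_def)
  \<comment> \<open>The sets satisfying \<open>At\<close> are the atoms: members of \<open>F\<close>
    with minimal growth \<open>\<kappa>\<close> and, among those, minimal size
    \<open>\<alpha>\<close>.\<close>
  define At where "At X \<longleftrightarrow> F X \<and> card (X <#> B) = card X + \<kappa> \<and> card X = \<alpha>" for X
  have min: "\<alpha> \<le> card Y" if "F Y" "card (Y <#> B) \<le> card Y + \<kappa>" for Y
  proof -
    have "\<delta> Y = \<kappa>" using kle[OF that(1)] that(2) by (simp add: \<delta>_def)
    then show ?thesis using X2min[OF that(1)] by (simp add: \<alpha>_def)
  qed
  have At2: "At X2"
    using X2 le[of X2] by (auto simp: At_def \<alpha>_def \<delta>_def F_def)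
  \<comment> \<open>The inverted complement \<open>?W\<close> of \<open>X <#> B\<close> satisfies
    \<open>?W <#> B \<subseteq> (carrier G - X)\<close> inverted. So \<open>?W\<close> is in
    \<open>F\<close> and also grows by at most \<open>\<kappa>\<close>, whence
    \<open>\<alpha>\<close> is at most its size, the order of the group minus
    \<open>\<alpha> + \<kappa>\<close>.\<close>
  have dual: "2 * \<alpha> + \<kappa> \<le> card (carrier G)" if "At X" for X
  proof -
    have X: "X \<subseteq> carrier G" "X \<noteq> {}" "X <#> B \<noteq> carrier G" using that by (auto simp: At_def F_def)
    let ?C = "carrier G - (X <#> B)"
    let ?W = "m_inv G ` ?C"
    have WC: "?W \<subseteq> carrier G" by auto
    have W0: "?W \<noteq> {}" using X sub[OF X(1)] by auto
    have WB: "?W <#> B \<subseteq> m_inv G ` (carrier G - X)"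
    proof
      fix w assume "w \<in> ?W <#> B"
      then obtain y b where yb: "y \<in> ?C" "b \<in> B" "w = inv y \<otimes> b"
        unfolding set_mult_def by auto
      have c: "y \<in> carrier G" "b \<in> carrier G" using yb B by auto
      have "y \<otimes> inv b \<notin> X"
      proof
        assume "y \<otimes> inv b \<in> X"
        then have "(y \<otimes> inv b) \<otimes> b \<in> X <#> B" using yb(2) unfolding set_mult_def by blast
        then show False using yb(1) c by (simp add: m_assoc)
      qed
      moreover have "w = inv (y \<otimes> inv b)"
        using c yb(3) by (simp add: inv_mult_group m_comm)
      ultimately show "w \<in> m_inv G ` (carrier G - X)" using c by blast
    qed
    have cardW: "card ?W = card ?C"
      by (rule card_image, rule inj_on_inverseI[where g = "m_inv G"]) auto
    have c1: "card (?W <#> B) \<le> card (carrier G) - card X"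
    proof -
      have "card (?W <#> B) \<le> card (m_inv G ` (carrier G - X))"
        using WB fin by (intro card_mono) auto
      also have "\<dots> \<le> card (carrier G - X)" using fin by (intro card_image_le) auto
      finally show ?thesis using X fin by (simp add: card_Diff_subset finS)
    qed
    have c2: "card ?C = card (carrier G) - card (X <#> B)"
      using X fin sub finS by (simp add: card_Diff_subset)
    have cX: "card X > 0" "card (X <#> B) = \<alpha> + \<kappa>" "card X = \<alpha>"
      using X finS[OF X(1)] that by (auto simp: At_def card_gt_0_iff)
    have cle: "card (X <#> B) \<le> card (carrier G)" using sub[OF X(1)] fin by (rule card_mono[rotated])
    have "?W <#> B \<noteq> carrier G"
    proof
      assume "?W <#> B = carrier G"
      then have "card (carrier G) \<le> card (carrier G) - card X" using c1 by simp
      then show False using cX cle by linarith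
    qed
    then have "F ?W" using WC W0 by (simp add: F_def)
    then have "\<alpha> \<le> card ?W"
      by (rule min) (use c1 c2 cX cle cardW in linarith)
    then show ?thesis using cardW c2 cX cle by linarith
  qed
  \<comment> \<open>Submodularity shows that \<open>X \<inter> Y\<close> grows by at most
    \<open>\<kappa>\<close>, so minimality of \<open>\<alpha>\<close> makes it all of
    \<open>X\<close> and of \<open>Y\<close>. If the union already produces the whole group,
    \<open>kle\<close> says nothing about it, and \<open>dual\<close> supplies the lower bound on
    the group order instead.\<close>
  have inter: "X = Y" if "At X" "At Y" "X \<inter> Y \<noteq> {}" for X Y
  proof -
    let ?Z = "X \<inter> Y"
    have X: "X \<subseteq> carrier G" "X <#> B \<noteq> carrier G" and Y: "Y \<subseteq> carrier G"
      using that by (auto simp: At_def F_def)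
    have ZB: "?Z <#> B \<subseteq> (X <#> B) \<inter> (Y <#> B)" unfolding set_mult_def by blast
    have U: "(X \<union> Y) <#> B = (X <#> B) \<union> (Y <#> B)" unfolding set_mult_def by blast
    have FZ: "F ?Z" using that(3) X ZB sub[OF X(1)] by (auto simp: F_def)
    have "card (?Z <#> B) \<le> card ((X <#> B) \<inter> (Y <#> B))"
      using ZB finS[OF X(1)] by (intro card_mono) auto
    moreover have "card (X <#> B) + card (Y <#> B)
        = card ((X \<union> Y) <#> B) + card ((X <#> B) \<inter> (Y <#> B))"
      unfolding U using card_Un_Int[OF finS(2)[OF X(1)] finS(2)[OF Y]] .
    moreover have "card X + card Y = card (X \<union> Y) + card ?Z"
      using card_Un_Int[OF finS(1)[OF X(1)] finS(1)[OF Y]] .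
    moreover have "card ?Z > 0" using that(3) finS(1)[OF X(1)] by (simp add: card_gt_0_iff)
    moreover note kle[OF FZ] dual[OF that(1)]
    moreover have "F (X \<union> Y)" if "(X \<union> Y) <#> B \<noteq> carrier G"
      using that X Y FZ by (auto simp: F_def)
    then have "(X \<union> Y) <#> B = carrier G \<or> card (X \<union> Y) + \<kappa> \<le> card ((X \<union> Y) <#> B)"
      using kle by blast
    ultimately have "card (?Z <#> B) \<le> card ?Z + \<kappa>"
      using that by (auto simp: At_def)
    then have "\<alpha> \<le> card ?Z" using min FZ by blast
    then have "?Z = X" "?Z = Y"
      using that card_seteq[OF finS(1)[OF X(1)], of ?Z] card_seteq[OF finS(1)[OF Y], of ?Z]
      by (auto simp: At_def)
    then show ?thesis by simp
  qed
  have trans: "At ((\<lambda>x. g \<otimes> x) ` X)" if "At X" and g: "g \<in> carrier G" for X g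
  proof -
    have X: "X \<subseteq> carrier G" "X <#> B \<noteq> carrier G" "X \<noteq> {}" using that by (auto simp: At_def F_def)
    have inj: "inj_on (\<lambda>x. g \<otimes> x) (carrier G)" using g by (auto simp: inj_on_def)
    have eq: "(\<lambda>x. g \<otimes> x) ` X <#> B = (\<lambda>x. g \<otimes> x) ` (X <#> B)"
    proof -
      have "(\<lambda>x. g \<otimes> x) ` X <#> B = (\<Union>x\<in>X. \<Union>b\<in>B. {g \<otimes> x \<otimes> b})"
        by (simp add: set_mult_def)
      also have "\<dots> = (\<Union>x\<in>X. \<Union>b\<in>B. {g \<otimes> (x \<otimes> b)})"
        using X B g by (intro SUP_cong HOL.refl) (simp add: m_assoc subset_iff)
      also have "\<dots> = (\<lambda>x. g \<otimes> x) ` (X <#> B)"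
        by (simp add: set_mult_def image_UN)
      finally show ?thesis .
    qed
    have c: "card ((\<lambda>x. g \<otimes> x) ` Y) = card Y" if "Y \<subseteq> carrier G" for Y
      using inj_on_subset[OF inj that] card_image by blast
    have "(\<lambda>x. g \<otimes> x) ` (X <#> B) \<noteq> carrier G"
    proof
      assume "(\<lambda>x. g \<otimes> x) ` (X <#> B) = carrier G"
      then have "card (X <#> B) = card (carrier G)" using c sub[OF X(1)] by metis
      then show False using X card_subset_eq[OF fin sub[OF X(1)]] by simp
    qed
    then show ?thesis using that X c[OF X(1)] c[OF sub[OF X(1)]] g
      by (auto simp: At_def F_def eq)
  qed
  obtain g where g: "g \<in> X2" "g \<in> carrier G" using X2 by (auto simp: F_def)
  define H where "H = (\<lambda>x. inv g \<otimes> x) ` X2"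
  have AtH: "At H" unfolding H_def using trans At2 g by blast
  have oneH: "\<one> \<in> H" unfolding H_def using g by force
  have HC: "H \<subseteq> carrier G" and HB: "H <#> B \<noteq> carrier G" using AtH by (auto simp: At_def F_def)
  have shift: "(\<lambda>x. inv h \<otimes> x) ` H = H" if "h \<in> H" for h
  proof -
    have h: "h \<in> carrier G" using that HC by auto
    have "\<one> \<in> (\<lambda>x. inv h \<otimes> x) ` H" using that h by force
    then show ?thesis using inter[OF trans[OF AtH, of "inv h"] AtH] oneH h by blast
  qed
  have subH: "subgroup H G"
  proof (rule subgroupI)
    show "inv a \<in> H" if "a \<in> H" for a
    proof -
      have "inv a \<otimes> \<one> \<in> (\<lambda>x. inv a \<otimes> x) ` H" using oneH by blast
      then show ?thesis using shift[OF that] that HC by auto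
    qed
    then show "a \<otimes> b \<in> H" if "a \<in> H" "b \<in> H" for a b
    proof -
      have "inv (inv a) \<otimes> b \<in> (\<lambda>x. inv (inv a) \<otimes> x) ` H" using that by blast
      then show ?thesis using shift[of "inv a"] that HC \<open>\<And>a. a \<in> H \<Longrightarrow> inv a \<in> H\<close> by auto
    qed
  qed (use HC oneH in auto)
  have "H \<noteq> carrier G"
    using HB subset_set_mult_one[OF fin HC B one] sub[OF HC] by blast
  then obtain b where b: "b \<in> B" "b \<notin> H" using gen[OF subH] by blast
  have bC: "b \<in> carrier G" using b B by auto
  have "H \<inter> (\<lambda>x. x \<otimes> b) ` H = {}"
  proof -
    have "b \<in> H" if "h \<in> H" "h \<otimes> b \<in> H" for h
    proof -
      have "inv h \<otimes> (h \<otimes> b) \<in> H"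
        using subgroup.m_closed[OF subH subgroup.m_inv_closed[OF subH that(1)] that(2)] .
      then show ?thesis using that HC bC by (simp add: m_assoc[symmetric] subset_iff)
    qed
    then show ?thesis using b by auto
  qed
  moreover have "card ((\<lambda>x. x \<otimes> b) ` H) = card H"
    using HC bC by (intro card_image) (auto simp: inj_on_def subset_iff)
  moreover have "H \<union> (\<lambda>x. x \<otimes> b) ` H \<subseteq> H <#> B"
    using subset_set_mult_one[OF fin HC B one] b unfolding set_mult_def by blast
  ultimately have "2 * card H \<le> card (H <#> B)"
    using finS[OF HC] card_mono[of "H <#> B" "H \<union> (\<lambda>x. x \<otimes> b) ` H"]
    by (simp add: card_Un_disjoint)
  \<comment> \<open>The two disjoint cosets give \<open>card H \<le> \<kappa>\<close>, so
    \<open>card B \<le> card H + \<kappa> \<le> 2 * \<kappa>\<close>. The growth of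
    \<open>X0\<close> is at least \<open>\<kappa>\<close>.\<close>
  moreover have "B \<subseteq> H <#> B" using oneH B unfolding set_mult_def by force
  then have "card B \<le> card (H <#> B)" using finS[OF HC] card_mono by blast
  moreover have "card (H <#> B) = card H + \<kappa>" using AtH by (simp add: At_def)
  moreover note kle[OF \<open>F X0\<close>]
  ultimately show ?thesis by linarith
qed simp

section \<open>Sums of sets of integers\<close>

text \<open>Translating \<open>B\<close> by the minimum of \<open>A\<close>, and \<open>A\<close> by
  the maximum of \<open>B\<close>, gives two subsets of the sumset that can meet only at the sum of
  these two extremes.\<close>

lemma card_sumset_ge:
  fixes A B :: "int set"
  assumes "finite A" "finite B" "A \<noteq> {}" "B \<noteq> {}"
  shows "card A + card B \<le> card (A + B) + 1"
proof -
  let ?P = "(+) (Min A) ` B" and ?Q = "(\<lambda>a. a + Max B) ` A"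
  have mem: "Min A \<in> A" "Max B \<in> B" using assms by auto
  have "?P \<inter> ?Q \<subseteq> {Min A + Max B}"
  proof
    fix z assume "z \<in> ?P \<inter> ?Q"
    then obtain a b where ab: "a \<in> A" "b \<in> B" "z = Min A + b" "z = a + Max B" by auto
    have "Min A \<le> a" "b \<le> Max B" using assms ab by auto
    then show "z \<in> {Min A + Max B}" using ab by auto
  qed
  then have "card (?P \<inter> ?Q) \<le> 1" using card_mono[of "{Min A + Max B}" "?P \<inter> ?Q"] by simp
  moreover have "card ?P = card B" "card ?Q = card A" by (auto intro!: card_image simp: inj_on_def)
  moreover have "card ?P + card ?Q = card (?P \<union> ?Q) + card (?P \<inter> ?Q)"
    using assms by (intro card_Un_Int) auto
  moreover have "?P \<union> ?Q \<subseteq> A + B" using mem by auto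
  then have "card (?P \<union> ?Q) \<le> card (A + B)"
    using assms by (intro card_mono finite_set_plus)
  ultimately show ?thesis by linarith
qed

lemma sumset_mod_disjoint:
  fixes X Y B :: "int set"
  assumes XY: "\<And>x y. x \<in> X \<Longrightarrow> y \<in> Y \<Longrightarrow> x mod d \<noteq> y mod d"
    and B: "\<And>b. b \<in> B \<Longrightarrow> b mod d = c"
  shows "(X + B) \<inter> (Y + B) = {}"
proof -
  have False if "x \<in> X" "y \<in> Y" "b \<in> B" "b' \<in> B" "x + b = y + b'" for x y b b'
  proof -
    have "d dvd b' - b" using that B[of b] B[of b'] by (simp add: mod_eq_dvd_iff[symmetric])
    moreover have "x - y = b' - b" using that by simp
    ultimately have "x mod d = y mod d" by (simp add: mod_eq_dvd_iff)
    then show False using XY that by simp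
  qed
  then show ?thesis by (auto simp: set_plus_def)
qed

lemma card_sumset_mod_class:
  fixes A B :: "int set"
  assumes "finite A" "finite B" and B: "\<And>b. b \<in> B \<Longrightarrow> b mod d = c"
  shows "card (A + B) = card ({a \<in> A. a mod d = e} + B) + card ({a \<in> A. a mod d \<noteq> e} + B)"
proof -
  let ?X = "{a \<in> A. a mod d = e}" and ?Y = "{a \<in> A. a mod d \<noteq> e}"
  have eq: "A + B = (?X + B) \<union> (?Y + B)" by (auto simp: set_plus_def)
  have "(?X + B) \<inter> (?Y + B) = {}"
    by (rule sumset_mod_disjoint[OF _ B]) auto
  then show ?thesis unfolding eq using assms by (intro card_Un_disjoint finite_set_plus) auto
qed

lemma card_mod_class:
  fixes A :: "int set"
  assumes "finite A"
  shows "card A = card {a \<in> A. a mod d = e} + card {a \<in> A. a mod d \<noteq> e}"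
proof -
  have eq: "A = {a \<in> A. a mod d = e} \<union> {a \<in> A. a mod d \<noteq> e}" by auto
  show ?thesis by (subst eq, rule card_Un_disjoint) (use assms in auto)
qed

text \<open>Since \<open>B\<close> stays in one class mod \<open>d\<close>, the class of
  \<open>x\<close> in \<open>A\<close> and its complement have disjoint sums with \<open>B\<close>.
  The elementary bound applies to each, so \<open>B\<close> is counted twice.\<close>

lemma card_sumset_two_classes:
  fixes A B :: "int set"
  assumes "finite A" "finite B" "B \<noteq> {}" and B: "\<And>b. b \<in> B \<Longrightarrow> b mod d = c"
    and "x \<in> A" "y \<in> A" "x mod d \<noteq> y mod d"
  shows "card A + 2 * card B \<le> card (A + B) + 2"
proof -
  let ?X = "{a \<in> A. a mod d = x mod d}" and ?Y = "{a \<in> A. a mod d \<noteq> x mod d}"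
  have ne: "?X \<noteq> {}" "?Y \<noteq> {}" and f: "finite ?X" "finite ?Y" using assms(1,5-7) by auto
  have "card ?X + card B \<le> card (?X + B) + 1" "card ?Y + card B \<le> card (?Y + B) + 1"
    using card_sumset_ge[of ?X B] card_sumset_ge[of ?Y B] ne f assms(2,3) by auto
  then show ?thesis
    using card_sumset_mod_class[OF assms(1,2) B, of "x mod d"] card_mod_class[OF assms(1), of d "x mod d"]
    by linarith
qed

lemma card_sumset_three_classes:
  fixes A B :: "int set"
  assumes "finite A" "finite B" "B \<noteq> {}" and B: "\<And>b. b \<in> B \<Longrightarrow> b mod d = c"
    and "x \<in> A" "y \<in> A" "z \<in> A" "x mod d \<noteq> y mod d" "x mod d \<noteq> z mod d" "y mod d \<noteq> z mod d"
  shows "card A + 3 * card B \<le> card (A + B) + 3"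
proof -
  let ?X = "{a \<in> A. a mod d = x mod d}" and ?Y = "{a \<in> A. a mod d \<noteq> x mod d}"
  have "?X \<noteq> {}" "finite ?X" using assms(1,5) by auto
  then have "card ?X + card B \<le> card (?X + B) + 1"
    using card_sumset_ge[of ?X B] assms(2,3) by auto
  moreover have "card ?Y + 2 * card B \<le> card (?Y + B) + 2"
    by (rule card_sumset_two_classes[where x = y and y = z, OF _ assms(2,3) B]) (use assms in auto)
  ultimately show ?thesis
    using card_sumset_mod_class[OF assms(1,2) B, of "x mod d"] card_mod_class[OF assms(1), of d "x mod d"]
    by linarith
qed

text \<open>\<open>K\<close> is an additive subgroup whose least positive element exists thanks to
  \<open>l\<close> and, by division with remainder, divides all of \<open>B\<close>; so it is
  1.\<close>

lemma int_subgroup_eq_UNIV: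
  fixes K :: "int set"
  assumes diff: "\<And>x y. x \<in> K \<Longrightarrow> y \<in> K \<Longrightarrow> x - y \<in> K"
    and l: "l \<in> K" "l > 0" and B: "B \<subseteq> K" "Gcd B = 1"
  shows "K = UNIV"
proof -
  have zero: "0 \<in> K" using diff[OF l(1) l(1)] by simp
  have neg: "- x \<in> K" if "x \<in> K" for x using diff[OF zero that] by simp
  have add: "x + y \<in> K" if "x \<in> K" "y \<in> K" for x y using diff[OF that(1) neg[OF that(2)]] by simp
  have mult: "n * x \<in> K" if "x \<in> K" for n x
  proof (induction n rule: int_induct[of _ 0])
    case base then show ?case using zero by simp
  next
    case (step1 i) then show ?case using add that by (simp add: algebra_simps)
  next
    case (step2 i) then show ?case using diff that by (simp add: algebra_simps)
  qed
  define P where "P n \<longleftrightarrow> n > 0 \<and> int n \<in> K" for n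
  have "P (nat l)" using l by (simp add: P_def)
  define m where "m = int (LEAST n. P n)"
  have Pm: "P (LEAST n. P n)" using \<open>P (nat l)\<close> by (rule LeastI)
  then have m: "m > 0" "m \<in> K" by (auto simp: m_def P_def)
  have "m dvd b" if "b \<in> B" for b
  proof -
    have "b - (b div m) * m \<in> K" using diff mult m B that by blast
    then have "b mod m \<in> K" by (simp add: minus_div_mult_eq_mod)
    moreover have "0 \<le> b mod m" "b mod m < m" using m by auto
    moreover have "\<not> P (nat (b mod m))"
    proof (rule not_less_Least)
      show "nat (b mod m) < (LEAST n. P n)" using \<open>b mod m < m\<close> \<open>0 \<le> b mod m\<close> by (simp add: m_def)
    qed
    ultimately have "b mod m = 0" by (auto simp: P_def)
    then show ?thesis by auto
  qed
  then have "m dvd Gcd B" by (rule Gcd_greatest)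
  then have "m = 1" using m B by auto
  then have "n \<in> K" for n using mult[OF m(2), of n] by simp
  then show ?thesis by blast
qed

text \<open>
  If \<open>Gcd B\<close> does not divide all of \<open>A\<close>, then \<open>A\<close> splits into two classes modulo \<open>Gcd B\<close>. Otherwise \<open>B\<close>
  generates the integers mod \<open>l\<close>, and each residue of \<open>B\<close> is represented twice, by \<open>b\<close> and \<open>l + b\<close>.
\<close>

lemma card_sumset_long:
  fixes A B :: "int set"
  assumes A: "A \<subseteq> {0..l}" "0 \<in> A" "l \<in> A" "Gcd A = 1" and B: "B \<subseteq> {0..<l}" "0 \<in> B"
  shows "l + int (card B) \<le> int (card (A + B)) \<or> 2 * card A + 3 * card B \<le> 2 * card (A + B) + 3"
proof -
  have fin: "finite A" "finite B" using A B finite_subset by blast+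
  have l: "l > 0" using B by auto
  have cB: "card B \<ge> 1" using fin B by (auto simp: Suc_le_eq card_gt_0_iff)
  show ?thesis
  proof (cases "\<exists>x\<in>A. \<not> Gcd B dvd x")
    case True
    then obtain x where x: "x \<in> A" "\<not> Gcd B dvd x" by blast
    have "card A + 2 * card B \<le> card (A + B) + 2"
      by (rule card_sumset_two_classes[of _ _ "Gcd B" 0 x 0])
        (use fin A B x in \<open>auto simp: dvd_eq_mod_eq_0[symmetric] Gcd_dvd\<close>)
    \<comment> \<open>Doubling the two-class bound leaves a surplus \<open>card B\<close>, and
      \<open>card B \<ge> 1\<close> reduces the constant from 4 to 3.\<close>
    then show ?thesis using cB by linarith
  next
    case False
    then have "Gcd B dvd Gcd A" by (auto intro: Gcd_greatest)
    then have gB: "Gcd B = 1" using A(4) by simp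
    define n where "n = nat l"
    have n: "n \<noteq> 0" "int n = l" using l by (auto simp: n_def)
    let ?G = "integer_mod_group n"
    interpret G: comm_group ?G by (rule abelian_integer_mod_group)
    have car: "carrier ?G = {0..<l}" using n by (simp add: carrier_integer_mod_group)
    have mul: "x \<otimes>\<^bsub>?G\<^esub> y = (x + y) mod l" for x y using n by simp
    have one: "\<one>\<^bsub>?G\<^esub> = 0" by simp
    \<comment> \<open>Modulo \<open>l\<close> the endpoints 0 and \<open>l\<close> coincide, so
      removing \<open>l\<close> makes the remaining elements their own residues at the cost of one
      element.\<close>
    let ?X = "A - {l}"
    let ?C = "?X <#>\<^bsub>?G\<^esub> B"
    have "?C = carrier ?G \<or> 2 * card ?X + card B \<le> 2 * card ?C"
    proof (rule G.card_set_mult_generating)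
      show "finite (carrier ?G)" "B \<subseteq> carrier ?G" "\<one>\<^bsub>?G\<^esub> \<in> B" using B one car by auto
      show "?X \<subseteq> carrier ?G" using A car by (auto simp: subset_iff)
      show "?X \<noteq> {}" using A l by auto
      fix H assume H: "subgroup H ?G" "B \<subseteq> H"
      have Hc: "H \<subseteq> {0..<l}" using subgroup.subset[OF H(1)] car by simp
      have zero: "0 \<in> H" using subgroup.one_closed[OF H(1)] one by simp
      \<comment> \<open>The subgroup of the cyclic group is pulled back to the integers, where
        \<open>Gcd B = 1\<close> can be used.\<close>
      have "{z. z mod l \<in> H} = UNIV"
      proof (rule int_subgroup_eq_UNIV[where B = B and l = l])
        fix x y assume xy: "x \<in> {z. z mod l \<in> H}" "y \<in> {z. z mod l \<in> H}"
        have i: "inv\<^bsub>?G\<^esub> (y mod l) = (- y) mod l"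
        proof (rule G.inv_equality)
          show "(- y) mod l \<otimes>\<^bsub>?G\<^esub> (y mod l) = \<one>\<^bsub>?G\<^esub>" by (simp add: n(2) mod_add_eq)
        qed (use l car in \<open>simp_all\<close>)
        have "(x mod l) \<otimes>\<^bsub>?G\<^esub> inv\<^bsub>?G\<^esub> (y mod l) \<in> H"
          using xy subgroup.m_closed[OF H(1)] subgroup.m_inv_closed[OF H(1)] by simp
        then show "x - y \<in> {z. z mod l \<in> H}" by (simp add: i n(2) mod_add_eq)
      next
        show "B \<subseteq> {z. z mod l \<in> H}" using H B by (auto simp: subset_iff)
      qed (use l gB zero in auto)
      then have UH: "z mod l \<in> H" for z by blast
      have "x \<in> H" if "x \<in> {0..<l}" for x using UH[of x] that by simp
      then show "H = carrier ?G" using Hc car by auto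
    qed
    moreover have cX: "card ?X + 1 = card A" using card_Suc_Diff1[OF fin(1) A(3)] by simp
    moreover have "card ?C + card B \<le> card (A + B)"
    proof -
      \<comment> \<open>Deleting \<open>l + B\<close> loses no residue: \<open>l + b'\<close> is
        replaced by \<open>0 + b'\<close>, which survives because \<open>b' < l\<close>. So
        \<open>?D\<close> still covers \<open>?C\<close>, and \<open>card B\<close> further sums
        remain.\<close>
      let ?D = "(A + B) - (+) l ` B"
      have f: "finite (A + B)" using fin by (rule finite_set_plus)
      have "?C \<subseteq> (\<lambda>z. z mod l) ` ?D"
      proof
        fix c assume "c \<in> ?C"
        then obtain a b where ab: "a \<in> A" "b \<in> B" "c = (a + b) mod l"
          unfolding set_mult_def mul by auto
        show "c \<in> (\<lambda>z. z mod l) ` ?D"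
        proof (cases "a + b \<in> (+) l ` B")
          case True
          then obtain b' where b': "b' \<in> B" "a + b = l + b'" by auto
          have "0 + b' \<in> A + B" using A b' by (intro set_plus_intro) auto
          moreover have "b' \<noteq> l + x" if "x \<in> B" for x
          proof -
            have "b' < l" "0 \<le> x" using b'(1) that B(1) by auto
            then show ?thesis by linarith
          qed
          then have "b' \<notin> (+) l ` B" by blast
          moreover have "c = b' mod l" using ab b' by simp
          ultimately show ?thesis by auto
        next
          case False
          then show ?thesis using ab by (auto simp: set_plus_def)
        qed
      qed
      then have "card ?C \<le> card ?D"
        using f by (meson card_image_le card_mono finite_Diff finite_imageI le_trans)
      moreover have "(+) l ` B \<subseteq> A + B" using A by auto
      then have "card ?D = card (A + B) - card B" "card B \<le> card (A + B)"
        using fin f card_mono[OF f, of "(+) l ` B"] by (auto simp: card_Diff_subset card_image)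
      ultimately show ?thesis by linarith
    qed
    moreover have "int (card (carrier ?G)) = l" using car l by simp
    ultimately show ?thesis by (auto; linarith)
  qed
qed

text \<open>With \<open>u = Min X\<close> and \<open>X = u + r B\<close>, the sum
  \<open>X + r A\<close> is an affine copy of \<open>A + B\<close>. Elements of \<open>B\<close>
  satisfy \<open>r * b \<le> l\<close>, and \<open>r \<ge> 2\<close> makes them smaller than
  \<open>l\<close>, as \<open>card_sumset_long\<close> requires.\<close>

lemma card_class_sum_dilate:
  fixes A :: "int set" and r :: int
  assumes A: "A \<subseteq> {0..l}" "0 \<in> A" "l \<in> A" "Gcd A = 1" and l: "l \<ge> 1" and r: "r \<ge> 2"
    and ne: "{a \<in> A. a mod r = e} \<noteq> {}"
  defines "X \<equiv> {a \<in> A. a mod r = e}"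
  shows "l + int (card X) \<le> int (card (X + (*) r ` A)) \<or>
    2 * card A + 3 * card X \<le> 2 * card (X + (*) r ` A) + 3"
proof -
  have fin: "finite A" using A finite_subset by blast
  have finX: "finite X" "X \<noteq> {}" using fin ne by (auto simp: X_def)
  define u where "u = Min X"
  have u: "u \<in> X" "\<And>x. x \<in> X \<Longrightarrow> u \<le> x" using finX by (auto simp: u_def)
  define B where "B = (\<lambda>a. (a - u) div r) ` X"
  have dv: "u + r * ((a - u) div r) = a" if "a \<in> X" for a
  proof -
    have "a mod r = u mod r" using that u by (simp add: X_def)
    then have "r dvd a - u" by (simp only: mod_eq_dvd_iff)
    then show ?thesis by simp
  qed
  have XB: "X = (\<lambda>b. u + r * b) ` B" unfolding B_def image_image using dv by (force simp: image_iff)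
  have inj: "inj_on (\<lambda>b. u + r * b) Y" for Y using r by (auto simp: inj_on_def)
  have cB: "card B = card X" unfolding XB using card_image[OF inj] by metis
  have "X + (*) r ` A = (\<lambda>z. u + r * z) ` (A + B)"
    unfolding XB set_plus_def by (force simp: algebra_simps)
  then have c: "card (X + (*) r ` A) = card (A + B)" using card_image[OF inj] by metis
  have "B \<subseteq> {0..<l}"
  proof
    fix b assume "b \<in> B"
    then obtain a where a: "a \<in> X" "b = (a - u) div r" by (auto simp: B_def)
    have "r * b \<le> l" using dv[OF a(1)] a u A by (auto simp: X_def subset_iff) (smt (verit))
    moreover have b0: "0 \<le> b" using a u(2)[OF a(1)] r by (simp add: pos_imp_zdiv_nonneg_iff)
    then have "2 * b \<le> r * b" using r by (intro mult_right_mono) auto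
    ultimately show "b \<in> {0..<l}" using b0 l by auto
  qed
  moreover have "0 \<in> B" using u by (force simp: B_def)
  ultimately show ?thesis using card_sumset_long[OF A] c cB by metis
qed

section \<open>Sums of dilates\<close>

text \<open>Together with \<open>0 \<in> A\<close> this provides two residue classes mod
  \<open>r\<close>.\<close>

lemma mod_classes_gcd_one:
  fixes A :: "int set"
  assumes "Gcd A = 1" "r \<ge> 2"
  obtains x where "x \<in> A" "x mod r \<noteq> 0"
proof -
  have "\<not> (\<forall>x\<in>A. r dvd x)"
  proof
    assume "\<forall>x\<in>A. r dvd x"
    then have "r dvd Gcd A" by (auto intro: Gcd_greatest)
    then show False using assms by auto
  qed
  then show ?thesis using that by (auto simp: dvd_eq_mod_eq_0)
qed

text \<open>If the even and the odd class both had the second alternative of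
  \<open>card_class_sum_dilate\<close>, adding the two would contradict \<open>small\<close>. So one
  class has the bound involving \<open>l\<close>; adding the elementary bound for the other gives
  the claim.\<close>

lemma card_sum_dilate_2_normalised:
  fixes A :: "int set"
  assumes A: "A \<subseteq> {0..l}" "0 \<in> A" "l \<in> A" "Gcd A = 1" and l: "l \<ge> 1"
    and small: "2 * card (A + (*) 2 ` A) + 8 < 7 * card A"
  shows "l + 2 * int (card A) \<le> int (card (A + (*) 2 ` A)) + 1"
proof -
  have fin: "finite A" using A finite_subset by blast
  obtain x where x: "x \<in> A" "x mod 2 \<noteq> 0" using mod_classes_gcd_one[OF A(4), of 2] by auto
  let ?B = "(*) (2::int) ` A"
  define X where "X = {a \<in> A. a mod 2 = 0}"
  define Y where "Y = {a \<in> A. a mod 2 = 1}"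
  have Y': "{a \<in> A. a mod 2 \<noteq> 0} = Y" by (auto simp: Y_def)
  have ne: "X \<noteq> {}" "Y \<noteq> {}" using A(2) x by (auto simp: X_def Y_def)
  have B0: "?B \<noteq> {}" using A(2) by auto
  have cB: "card ?B = card A" by (auto intro!: card_image simp: inj_on_def)
  have f: "finite X" "finite Y" "finite ?B" using fin by (auto simp: X_def Y_def)
  have split: "card (A + ?B) = card (X + ?B) + card (Y + ?B)"
    unfolding X_def Y'[symmetric] by (rule card_sumset_mod_class[OF fin f(3), where c = 0]) auto
  have split': "card A = card X + card Y"
    unfolding X_def Y'[symmetric] by (rule card_mod_class[OF fin])
  have "card X + card ?B \<le> card (X + ?B) + 1" "card Y + card ?B \<le> card (Y + ?B) + 1"
    using card_sumset_ge[OF f(1,3) ne(1) B0] card_sumset_ge[OF f(2,3) ne(2) B0] by simp_all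
  moreover have "card X > 0" "card Y > 0" using ne f by (auto simp: card_gt_0_iff)
  moreover have "l + int (card X) \<le> int (card (X + ?B)) \<or> 2 * card A + 3 * card X \<le> 2 * card (X + ?B) + 3"
    unfolding X_def using card_class_sum_dilate[OF A l, of 2 0] ne by (simp add: X_def)
  moreover have "l + int (card Y) \<le> int (card (Y + ?B)) \<or> 2 * card A + 3 * card Y \<le> 2 * card (Y + ?B) + 3"
    unfolding Y_def using card_class_sum_dilate[OF A l, of 2 1] ne by (simp add: Y_def)
  ultimately show ?thesis using small split split' cB by linarith
qed

lemma card_residue_class_le:
  fixes A :: "int set"
  assumes "A \<subseteq> {0..l}" "r > 0" "l \<ge> 0"
  shows "int (card {a \<in> A. a mod r = e}) \<le> l div r + 1"
proof -
  let ?X = "{a \<in> A. a mod r = e}"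
  have "inj_on (\<lambda>a. a div r) ?X"
    by (rule inj_onI) (metis (mono_tags, lifting) mem_Collect_eq mult_div_mod_eq)
  moreover have "(\<lambda>a. a div r) ` ?X \<subseteq> {0..l div r}"
    using assms by (auto simp: pos_imp_zdiv_nonneg_iff intro!: zdiv_mono1)
  ultimately have "card ?X \<le> card {0..l div r}" by (metis card_inj_on_le finite_atLeastAtMost_int)
  moreover have "0 \<le> l div r" using assms by (simp add: pos_imp_zdiv_nonneg_iff)
  ultimately show ?thesis by simp
qed

text \<open>Three residue classes give \<open>4 * card A - 3\<close> at once. With two classes the
  only obstacle is the alternative involving \<open>l\<close>; but a class mod
  \<open>r \<ge> 4\<close> has at most \<open>l div 4 + 1\<close> elements, so \<open>l\<close> is
  at least \<open>2 * card A - 4\<close>, which suffices because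
  \<open>card A \<ge> 2\<close>.\<close>

lemma card_sum_dilate_ge4_normalised:
  fixes A :: "int set"
  assumes A: "A \<subseteq> {0..l}" "0 \<in> A" "l \<in> A" "Gcd A = 1" and l: "l \<ge> 1" and r: "r \<ge> 4"
  shows "7 * card A \<le> 2 * card (A + (*) r ` A) + 8"
proof -
  have fin: "finite A" using A finite_subset by blast
  obtain x where x: "x \<in> A" "x mod r \<noteq> 0" using mod_classes_gcd_one[OF A(4), of r] r by auto
  let ?B = "(*) r ` A"
  have B0: "?B \<noteq> {}" using A(2) by auto
  have cB: "card ?B = card A" using r by (auto intro!: card_image simp: inj_on_def)
  have "{0, x} \<subseteq> A" "x \<noteq> 0" using A x by auto
  then have k2: "card A \<ge> 2" using card_mono[OF fin, of "{0, x}"] by auto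
  show ?thesis
  proof (cases "\<exists>y\<in>A. y mod r \<noteq> 0 \<and> y mod r \<noteq> x mod r")
    case True
    then obtain y where y: "y \<in> A" "y mod r \<noteq> 0" "y mod r \<noteq> x mod r" by blast
    have "card A + 3 * card ?B \<le> card (A + ?B) + 3"
      by (rule card_sumset_three_classes[of _ _ r 0 0 x y]) (use fin A x y in auto)
    then show ?thesis using cB k2 by linarith
  next
    case False
    define X where "X = {a \<in> A. a mod r = 0}"
    define Y where "Y = {a \<in> A. a mod r = x mod r}"
    have Y': "{a \<in> A. a mod r \<noteq> 0} = Y" using False x by (auto simp: Y_def)
    have ne: "X \<noteq> {}" "Y \<noteq> {}" using A(2) x by (auto simp: X_def Y_def)
    have f: "finite X" "finite Y" "finite ?B" using fin by (auto simp: X_def Y_def)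
    have split: "card (A + ?B) = card (X + ?B) + card (Y + ?B)"
      unfolding X_def Y'[symmetric] by (rule card_sumset_mod_class[OF fin f(3), where c = 0]) auto
    have split': "card A = card X + card Y"
      unfolding X_def Y'[symmetric] by (rule card_mod_class[OF fin])
    have "card X + card ?B \<le> card (X + ?B) + 1" "card Y + card ?B \<le> card (Y + ?B) + 1"
      using card_sumset_ge[OF f(1,3) ne(1) B0] card_sumset_ge[OF f(2,3) ne(2) B0] by simp_all
    moreover have "card X > 0" "card Y > 0" using ne f by (auto simp: card_gt_0_iff)
    moreover have "l + int (card X) \<le> int (card (X + ?B)) \<or> 2 * card A + 3 * card X \<le> 2 * card (X + ?B) + 3"
      unfolding X_def using card_class_sum_dilate[OF A l, of r 0] ne r by (simp add: X_def)
    moreover have "l + int (card Y) \<le> int (card (Y + ?B)) \<or> 2 * card A + 3 * card Y \<le> 2 * card (Y + ?B) + 3"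
      unfolding Y_def using card_class_sum_dilate[OF A l, of r "x mod r"] ne r by (simp add: Y_def)
    moreover have "int (card X) \<le> l div r + 1" "int (card Y) \<le> l div r + 1"
      unfolding X_def Y_def using card_residue_class_le[OF A(1)] r l by auto
    moreover have "4 * (l div r) \<le> l"
    proof -
      have "0 \<le> l div r" using r l by (simp add: pos_imp_zdiv_nonneg_iff)
      then have "4 * (l div r) \<le> r * (l div r)" using r by (intro mult_right_mono) auto
      also have "\<dots> \<le> l" using r mult_div_mod_eq[of r l] pos_mod_sign[of r l] by linarith
      finally show ?thesis .
    qed
    ultimately show ?thesis using split split' cB k2 by linarith
  qed
qed

section \<open>Normalisation and the bounds for arbitrary finite sets of integers\<close>

lemma int_set_normalise:
  fixes A :: "int set"
  assumes fin: "finite A" and k: "card A \<ge> 2"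
  obtains u d l A' where "d \<ge> 1" "l \<ge> 1" "A = (\<lambda>a. u + d * a) ` A'"
    "A' \<subseteq> {0..l}" "0 \<in> A'" "l \<in> A'" "Gcd A' = 1" "card A' = card A"
proof -
  have ne: "A \<noteq> {}" using k by auto
  define u where "u = Min A"
  define D where "D = (\<lambda>a. a - u) ` A"
  define d where "d = Gcd D"
  define A' where "A' = (\<lambda>a. (a - u) div d) ` A"
  have u: "u \<in> A" "\<And>a. a \<in> A \<Longrightarrow> u \<le> a" using fin ne by (auto simp: u_def)
  obtain v where v: "v \<in> A" "v \<noteq> u"
    using k u(1) by (metis card_le_Suc0_iff_eq fin not_less_eq_eq numeral_2_eq_2)
  have "d \<noteq> 0" using v unfolding d_def D_def Gcd_0_iff by auto
  then have d: "d \<ge> 1" by (smt (verit) Gcd_int_greater_eq_0 d_def)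
  have dv: "u + d * ((a - u) div d) = a" if "a \<in> A" for a
  proof -
    have "d dvd a - u" unfolding d_def D_def using that by (intro Gcd_dvd) auto
    then show ?thesis by simp
  qed
  have AA: "A = (\<lambda>a. u + d * a) ` A'" unfolding A'_def image_image using dv by (force simp: image_iff)
  have inj: "inj_on (\<lambda>a. u + d * a) A'" using d by (auto simp: inj_on_def)
  have nn: "0 \<le> a" if "a \<in> A'" for a
    using that u d by (auto simp: A'_def pos_imp_zdiv_nonneg_iff)
  have fA': "finite A'" using fin by (simp add: A'_def)
  have zero: "0 \<in> A'" using u by (force simp: A'_def)
  have DA: "D = (*) d ` A'" unfolding D_def by (subst AA) (auto simp: image_image)
  have g: "Gcd A' = 1"
  proof -
    \<comment> \<open>\<open>d\<close> is the gcd of \<open>D\<close>, which is the dilate of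
      \<open>A'\<close> by \<open>d\<close>; cancelling \<open>d\<close> leaves gcd 1.\<close>
    have "d = normalize (d * Gcd A')" using Gcd_mult[of d A'] DA d_def by metis
    then have "d * Gcd A' = d * 1" by (metis mult_1_right normalize_Gcd normalize_idem normalize_mult)
    then show ?thesis using d by (simp only: mult_cancel_left) auto
  qed
  define l where "l = Max A'"
  have "A' \<noteq> {}" using zero by blast
  then have l: "l \<in> A'" "A' \<subseteq> {0..l}" using fA' nn by (auto simp: l_def)
  have "l \<noteq> 0"
  proof
    assume "l = 0"
    then have "A' = {0}" using l by auto
    then show False using g by simp
  qed
  then have "l \<ge> 1" using nn[OF l(1)] by simp
  moreover have "card A' = card A" unfolding AA using card_image[OF inj] by metis
  ultimately show ?thesis using that d AA l zero g by blast
qed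

lemma card_affine_sum_dilate:
  fixes A' :: "int set"
  assumes "d \<ge> (1::int)" "A = (\<lambda>a. u + d * a) ` A'"
  shows "card (A + (*) r ` A) = card (A' + (*) r ` A')"
proof -
  have inj: "inj_on (\<lambda>z. (u + r * u) + d * z) Y" for Y using assms by (auto simp: inj_on_def)
  have "A + (*) r ` A = (\<lambda>z. (u + r * u) + d * z) ` (A' + (*) r ` A')"
    unfolding assms(2) set_plus_def by (force simp: algebra_simps)
  then show ?thesis using card_image[OF inj] by metis
qed

text \<open>After normalisation the dilate lies in the class 0 mod \<open>r\<close> while
  \<open>A'\<close> meets two classes. A single point cannot be normalised and is treated
  apart.\<close>

lemma card_sum_dilate_ge:
  fixes A :: "int set"
  assumes fin: "finite A" "A \<noteq> {}" and r: "r \<ge> 2"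
  shows "3 * card A \<le> card (A + (*) r ` A) + 2"
proof (cases "card A \<ge> 2")
  case True
  from int_set_normalise[OF fin(1) True]
  obtain u d l A' where n: "d \<ge> 1" "l \<ge> 1" "A = (\<lambda>a. u + d * a) ` A'"
    "A' \<subseteq> {0..l}" "0 \<in> A'" "l \<in> A'" "Gcd A' = 1" "card A' = card A" .
  have fA': "finite A'" using n(4) finite_subset by blast
  obtain x where x: "x \<in> A'" "x mod r \<noteq> 0" using mod_classes_gcd_one[OF n(7) r] .
  have "card A' + 2 * card ((*) r ` A') \<le> card (A' + (*) r ` A') + 2"
    by (rule card_sumset_two_classes[of _ _ r 0 0 x]) (use fA' n x in auto)
  moreover have "card ((*) r ` A') = card A'" using r by (auto intro!: card_image simp: inj_on_def)
  ultimately show ?thesis using card_affine_sum_dilate[OF n(1,3), of r] n(8) by linarith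
next
  case False
  have "card A > 0" "card (A + (*) r ` A) > 0"
    using fin by (auto simp: card_gt_0_iff finite_set_plus set_plus_def)
  then show ?thesis using False by linarith
qed

lemma card_sum_dilate_ge4:
  fixes A :: "int set"
  assumes fin: "finite A" and k: "card A \<ge> 2" and r: "r \<ge> 4"
  shows "7 * card A \<le> 2 * card (A + (*) r ` A) + 8"
proof -
  from int_set_normalise[OF fin k]
  obtain u d l A' where n: "d \<ge> 1" "l \<ge> 1" "A = (\<lambda>a. u + d * a) ` A'"
    "A' \<subseteq> {0..l}" "0 \<in> A'" "l \<in> A'" "Gcd A' = 1" "card A' = card A" .
  show ?thesis
    using card_sum_dilate_ge4_normalised[OF n(4-7) n(2) r] card_affine_sum_dilate[OF n(1,3), of r] n(8)
    by simp
qed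

text \<open>The normalised bound on \<open>l\<close> says exactly that this length is at least
  \<open>l + 1\<close>; in particular the natural subtraction does not truncate. For
  \<open>card (A + 2A) = 3k - 2 + h\<close> the length is \<open>k + h\<close>.\<close>

lemma card_sum_dilate_2_small:
  fixes A :: "int set"
  assumes fin: "finite A" and k: "card A \<ge> 2"
    and small: "2 * card (A + (*) 2 ` A) + 8 < 7 * card A"
  obtains P where "arith_progression P (card (A + (*) 2 ` A) + 2 - 2 * card A)" "A \<subseteq> P"
proof -
  from int_set_normalise[OF fin k]
  obtain u d l A' where n: "d \<ge> 1" "l \<ge> 1" "A = (\<lambda>a. u + d * a) ` A'"
    "A' \<subseteq> {0..l}" "0 \<in> A'" "l \<in> A'" "Gcd A' = 1" "card A' = card A" .
  define m where "m = card (A + (*) 2 ` A) + 2 - 2 * card A"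
  have "l + 2 * int (card A) \<le> int (card (A + (*) 2 ` A)) + 1"
    using card_sum_dilate_2_normalised[OF n(4-7) n(2)] card_affine_sum_dilate[OF n(1,3), of 2] n(8) small
    by simp
  then have m: "l + 1 \<le> int m" by (simp add: m_def)
  have "A \<subseteq> (\<lambda>i. u + d * int i) ` {..<m}"
  proof
    fix a assume "a \<in> A"
    then obtain a' where a': "a' \<in> A'" "a = u + d * a'" using n(3) by auto
    have "0 \<le> a'" "a' \<le> l" using n(4) a' by auto
    then have "a = u + d * int (nat a')" "nat a' < m" using a' m by auto
    then show "a \<in> (\<lambda>i. u + d * int i) ` {..<m}" by blast
  qed
  moreover have "arith_progression ((\<lambda>i. u + d * int i) ` {..<m}) m"
    unfolding arith_progression_def using n(1) by (intro exI[of _ u] exI[of _ d]) auto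
  ultimately show ?thesis using that by (simp add: m_def)
qed

text \<open>
  For the two levels \<open>0\<close> and \<open>m\<close> with \<open>r = 2\<^sup>m\<close>. If \<open>d\<close> is the gcd of the differences of \<open>A\<close>, then \<open>rA\<close>
  lies in one class mod \<open>2d\<close> while \<open>A\<close> meets two, and one of these two is disjoint from the class of \<open>rA\<close>.
\<close>

lemma card_bottom_levels:
  fixes A B :: "int set"
  assumes fin: "finite A" "finite B" and ne: "A \<noteq> {}" "B \<noteq> {}" and r: "even r" "r \<noteq> 0"
  shows "7 * card A + card B \<le> 2 * card (A + A) + 2 * card ((A + B) \<union> ((*) r ` A + B)) + 4"
proof -
  let ?rA = "(*) r ` A"
  let ?U = "(A + B) \<union> (?rA + B)"
  have c0: "card A > 0" "card B > 0" using fin ne by (auto simp: card_gt_0_iff)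
  have crA: "card ?rA = card A" using r by (auto intro!: card_image simp: inj_on_def)
  have fs: "finite (A + B)" "finite (?rA + B)" "finite (A + A)" using fin by (auto intro!: finite_set_plus)
  have U: "card (A + B) \<le> card ?U" "card (?rA + B) \<le> card ?U" using fs by (auto intro!: card_mono)
  have AB: "card A + card B \<le> card (A + B) + 1" and AA: "card A + card A \<le> card (A + A) + 1"
    using card_sumset_ge fin ne by blast+
  show ?thesis
  proof (cases "card A \<ge> 2")
    case False
    then have "card A = 1" using c0 by linarith
    then show ?thesis using U AB AA c0 by simp
  next
    case True
    from int_set_normalise[OF fin(1) True]
    obtain u d l A' where n: "d \<ge> 1" "l \<ge> 1" "A = (\<lambda>a. u + d * a) ` A'"
      "A' \<subseteq> {0..l}" "0 \<in> A'" "l \<in> A'" "Gcd A' = 1" "card A' = card A" .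
    obtain v where v: "v \<in> B" using ne by blast
    have modd: "a mod d = u mod d" if "a \<in> A" for a using that n(3) by auto
    \<comment> \<open>The elements of \<open>A\<close> agree mod \<open>d\<close>, so multiplication
      by the even number \<open>r\<close> makes them agree mod \<open>2 * d\<close>.\<close>
    have rmod: "z mod (2 * d) = (r * u) mod (2 * d)" if "z \<in> ?rA" for z
    proof -
      from that obtain a where a: "z = r * (u + d * a)" using n(3) by auto
      obtain s where "r = 2 * s" using r by auto
      then have "z = r * u + (2 * d) * (s * a)" using a by (simp add: algebra_simps)
      then show ?thesis by simp
    qed
    show ?thesis
    proof (cases "\<exists>w\<in>B. w mod (2 * d) \<noteq> v mod (2 * d)")
      case True
      then obtain w where w: "w \<in> B" "v mod (2 * d) \<noteq> w mod (2 * d)" by force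
      have "card B + 2 * card ?rA \<le> card (B + ?rA) + 2"
        by (rule card_sumset_two_classes[OF _ _ _ rmod v w]) (use fin ne in auto)
      then show ?thesis using U AA c0 crA by (simp add: add.commute[of B])
    next
      case False
      then have Bmod: "b mod (2 * d) = v mod (2 * d)" if "b \<in> B" for b using that by blast
      \<comment> \<open>\<open>A\<close> meets exactly the classes of \<open>u\<close> and
        \<open>u + d\<close> mod \<open>2 * d\<close>; \<open>h\<close> represents one that differs
        from the class of the dilate. \<open>Z\<close> is the part of \<open>A\<close> in the class
        of \<open>h\<close>, \<open>W\<close> the part in the other one.\<close>
      define h where "h = (if (r * u) mod (2 * d) = u mod (2 * d) then u + d else u)"
      obtain x where x: "x \<in> A'" "x mod 2 \<noteq> 0" using mod_classes_gcd_one[OF n(7), of 2] by auto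
      have h_or: "\<exists>a\<in>A. a mod (2 * d) = (u + d) mod (2 * d)"
      proof
        obtain y where "x = 2 * y + 1" using x by (meson odd_iff_mod_2_eq_one oddE even_iff_mod_2_eq_zero)
        then have "u + d * x = (u + d) + (2 * d) * y" by (simp add: algebra_simps)
        then show "(u + d * x) mod (2 * d) = (u + d) mod (2 * d)" by (simp only: mod_mult_self2)
        show "u + d * x \<in> A" using n(3) x by blast
      qed
      have u: "u \<in> A" using n(3,5) by force
      have dne: "(u + d) mod (2 * d) \<noteq> u mod (2 * d)"
      proof
        assume "(u + d) mod (2 * d) = u mod (2 * d)"
        then have "2 * d dvd d" by (simp add: mod_eq_dvd_iff)
        then show False using n(1) zdvd_not_zless[of d "2 * d"] by simp
      qed
      have two: "a mod (2 * d) = u mod (2 * d) \<or> a mod (2 * d) = (u + d) mod (2 * d)" if aA: "a \<in> A" for a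
      proof -
        obtain y where y: "a = u + d * y" using aA n(3) by auto
        show ?thesis
        proof (cases "even y")
          case True
          then obtain z where "y = 2 * z" by blast
          then have "a = u + (2 * d) * z" using y by simp
          then show ?thesis by (simp only: mod_mult_self2) simp
        next
          case False
          then obtain z where "y = 2 * z + 1" using oddE by blast
          then have "a = (u + d) + (2 * d) * z" using y by (simp add: algebra_simps)
          then show ?thesis by (simp only: mod_mult_self2) simp
        qed
      qed
      define Z where "Z = {a \<in> A. a mod (2 * d) = h mod (2 * d)}"
      define W where "W = {a \<in> A. a mod (2 * d) \<noteq> h mod (2 * d)}"
      have hr: "h mod (2 * d) \<noteq> (r * u) mod (2 * d)" using dne by (auto simp: h_def)
      have hu: "h = u \<or> h = u + d" by (simp add: h_def)
      have Z0: "Z \<noteq> {}" using hu h_or u by (auto simp: Z_def)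
      have W0: "W \<noteq> {}" using hu h_or u dne by (auto simp: W_def)
      have fZ: "finite Z" "finite W" using fin by (auto simp: Z_def W_def)
      have Wmod: "\<exists>c. \<forall>w\<in>W. w mod (2 * d) = c"
        using hu two by (auto simp: W_def intro: exI[of _ "u mod (2*d)"] exI[of _ "(u+d) mod (2*d)"])
      have cA: "card A = card Z + card W" using card_mod_class[OF fin(1)] by (simp add: Z_def W_def)
      have disj: "(Z + B) \<inter> (?rA + B) = {}"
        by (rule sumset_mod_disjoint[OF _ Bmod]) (use rmod hr in \<open>auto simp: Z_def\<close>)
      have "card (Z + B) + card (?rA + B) \<le> card ?U"
      proof -
        have "card ((Z + B) \<union> (?rA + B)) \<le> card ?U"
          using fs by (intro card_mono) (auto simp: Z_def set_plus_def)
        then show ?thesis using disj fZ fin fs(2) by (subst (asm) card_Un_disjoint) (auto intro: finite_set_plus)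
      qed
      moreover have "card Z + card B \<le> card (Z + B) + 1" "card ?rA + card B \<le> card (?rA + B) + 1"
        using card_sumset_ge fin fZ Z0 ne by auto
      moreover have "card A + 2 * card W \<le> card (A + W) + 2"
      proof -
        obtain c where c: "\<forall>w\<in>W. w mod (2 * d) = c" using Wmod by blast
        obtain z w where "z \<in> Z" "w \<in> W" using Z0 W0 by blast
        then have "z \<in> A" "w \<in> A" "z mod (2 * d) \<noteq> w mod (2 * d)" by (auto simp: Z_def W_def)
        from card_sumset_two_classes[OF fin(1) fZ(2) W0 _ this] c show ?thesis by blast
      qed
      moreover have "card (A + W) \<le> card (A + A)" using fs by (intro card_mono) (auto simp: W_def set_plus_def)
      moreover have "card Z > 0" "card W > 0" using Z0 W0 fZ by (auto simp: card_gt_0_iff)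
      \<comment> \<open>Either \<open>Z\<close> is about half of \<open>A\<close>, and the disjoint
        sums \<open>Z + B\<close> and \<open>?rA + B\<close> suffice, or \<open>W\<close> is large,
        and \<open>A + W\<close> improves the elementary bound for \<open>A + A\<close>.\<close>
      moreover have "card A \<le> 2 * card Z + 1 \<or> card A + 2 \<le> 2 * card W" using cA by linarith
      ultimately show ?thesis using crA cA AA c0 by linarith
    qed
  qed
qed

section \<open>Normal forms and centralizers\<close>

text \<open>Reading \<open>(m, x)\<close> as the affine map sending \<open>z\<close> to
  \<open>2^m z + x\<close>, this is composition with the left factor applied first.\<close>

definition bmul :: "nat \<times> int \<Rightarrow> nat \<times> int \<Rightarrow> nat \<times> int" where
  "bmul p q = (fst p + fst q, 2 ^ fst q * snd p + snd q)"

definition bprod :: "(nat \<times> int) set \<Rightarrow> (nat \<times> int) set \<Rightarrow> (nat \<times> int) set" where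
  "bprod P Q = (\<lambda>(p, q). bmul p q) ` (P \<times> Q)"

definition cen :: "nat \<times> int \<Rightarrow> (nat \<times> int) set" where
  "cen c = {q. bmul c q = bmul q c}"

lemma fst_bmul [simp]: "fst (bmul p q) = fst p + fst q"
  by (simp add: bmul_def)

lemma finite_bprod: "finite P \<Longrightarrow> finite Q \<Longrightarrow> finite (bprod P Q)"
  by (simp add: bprod_def)

lemma bprodI: "p \<in> P \<Longrightarrow> q \<in> Q \<Longrightarrow> bmul p q \<in> bprod P Q"
  by (auto simp: bprod_def)

lemma bprodE:
  assumes "z \<in> bprod P Q"
  obtains p q where "p \<in> P" "q \<in> Q" "z = bmul p q"
  using assms by (auto simp: bprod_def)

lemma fst_bprod:
  assumes "z \<in> bprod U V" "\<And>p. p \<in> U \<Longrightarrow> fst p = m" "\<And>p. p \<in> V \<Longrightarrow> fst p = n"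
  shows "fst z = m + n"
  using assms(1) by (rule bprodE) (simp add: assms(2,3))

lemma bprod_mono: "P \<subseteq> P' \<Longrightarrow> Q \<subseteq> Q' \<Longrightarrow> bprod P Q \<subseteq> bprod P' Q'"
  unfolding bprod_def by (intro image_mono Sigma_mono)

lemma bmul_left_cancel: "bmul p q = bmul p q' \<Longrightarrow> q = q'"
  by (auto simp: bmul_def prod_eq_iff)

lemma bmul_right_cancel: "bmul p q = bmul p' q \<Longrightarrow> p = p'"
  by (auto simp: bmul_def prod_eq_iff)

text \<open>For positive levels the equation says that the two affine maps have the same fixed
  point. It is linear in \<open>snd q\<close>, and the closure properties of \<open>cen\<close>
  reduce to calculation with it.\<close>

lemma mem_cen_iff: "q \<in> cen c \<longleftrightarrow> (2 ^ fst c - 1) * snd q = snd c * (2 ^ fst q - 1)"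
proof -
  have "q \<in> cen c \<longleftrightarrow> 2 ^ fst q * snd c + snd q = 2 ^ fst c * snd q + snd c"
    by (auto simp: cen_def bmul_def)
  also have "\<dots> \<longleftrightarrow> (2 ^ fst c - 1) * snd q = snd c * (2 ^ fst q - 1)"
    by (simp add: algebra_simps) linarith
  finally show ?thesis .
qed

lemma cen_level_inj:
  assumes "fst c \<ge> 1" "q \<in> cen c" "q' \<in> cen c" "fst q = fst q'"
  shows "q = q'"
proof -
  have "(2::int) ^ fst c \<noteq> 1" using self_le_power[of "2::int" "fst c"] assms(1) by simp
  moreover have "(2 ^ fst c - 1) * snd q = (2 ^ fst c - 1) * snd q'"
    using assms by (simp only: mem_cen_iff)
  ultimately show ?thesis using assms(4) by (simp add: prod_eq_iff)
qed

text \<open>Both second components are the same multiple of \<open>2^level - 1\<close>, namely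
  \<open>snd c / N\<close>; here \<open>N \<noteq> 0\<close> because the level of \<open>c\<close>
  is positive.\<close>

lemma cen_commute:
  assumes c: "fst c \<ge> 1" and "q \<in> cen c" "q' \<in> cen c"
  shows "q' \<in> cen q"
proof -
  define N where "N = (2::int) ^ fst c - 1"
  have N: "N \<noteq> 0" using self_le_power[of "2::int" "fst c"] c by (simp add: N_def)
  have e: "N * snd q = snd c * (2 ^ fst q - 1)" "N * snd q' = snd c * (2 ^ fst q' - 1)"
    using assms by (simp_all add: mem_cen_iff N_def)
  have "N * ((2 ^ fst q - 1) * snd q') = (2 ^ fst q - 1) * (N * snd q')" by (simp add: ac_simps)
  also have "\<dots> = (snd c * (2 ^ fst q - 1)) * (2 ^ fst q' - 1)" by (simp only: e ac_simps)
  also have "\<dots> = N * (snd q * (2 ^ fst q' - 1))" by (simp only: e(1)[symmetric] ac_simps)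
  finally show ?thesis using N by (simp add: mem_cen_iff)
qed

lemma cen_bmul:
  assumes "q \<in> cen c" "q' \<in> cen c"
  shows "bmul q q' \<in> cen c"
proof -
  define N where "N = (2::int) ^ fst c - 1"
  have e: "N * snd q = snd c * (2 ^ fst q - 1)" "N * snd q' = snd c * (2 ^ fst q' - 1)"
    using assms by (simp_all add: mem_cen_iff N_def)
  have "N * snd (bmul q q') = 2 ^ fst q' * (N * snd q) + N * snd q'"
    by (simp add: bmul_def algebra_simps)
  also have "\<dots> = snd c * (2 ^ fst (bmul q q') - 1)"
    unfolding e by (simp add: algebra_simps power_add)
  finally show ?thesis by (simp add: mem_cen_iff N_def)
qed

lemma cen_bmul_left:
  assumes "q \<in> cen c" "bmul q q' \<in> cen c"
  shows "q' \<in> cen c"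
proof -
  define N where "N = (2::int) ^ fst c - 1"
  have e: "N * snd q = snd c * (2 ^ fst q - 1)"
    "N * snd (bmul q q') = snd c * (2 ^ fst (bmul q q') - 1)"
    using assms by (simp_all only: mem_cen_iff N_def)
  have "N * snd q' = N * snd (bmul q q') - 2 ^ fst q' * (N * snd q)"
    by (simp add: bmul_def algebra_simps)
  also have "\<dots> = snd c * (2 ^ fst q' - 1)"
    unfolding e by (simp add: algebra_simps power_add)
  finally show ?thesis by (simp add: mem_cen_iff N_def)
qed

lemma cen_bmul_right:
  assumes "q' \<in> cen c" "bmul q q' \<in> cen c"
  shows "q \<in> cen c"
proof -
  define N where "N = (2::int) ^ fst c - 1"
  have e: "N * snd q' = snd c * (2 ^ fst q' - 1)"
    "N * snd (bmul q q') = snd c * (2 ^ fst (bmul q q') - 1)"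
    using assms by (simp_all only: mem_cen_iff N_def)
  have "2 ^ fst q' * (N * snd q) = N * snd (bmul q q') - N * snd q'"
    by (simp add: bmul_def algebra_simps)
  also have "\<dots> = 2 ^ fst q' * (snd c * (2 ^ fst q - 1))"
    unfolding e by (simp add: algebra_simps power_add)
  finally show ?thesis by (simp add: mem_cen_iff N_def)
qed

text \<open>The factor \<open>2^n + 1\<close>, with \<open>n\<close> the level of \<open>q\<close>,
  splits off from the equation for the square and is positive, hence cancels.\<close>

lemma cen_square:
  assumes "bmul q q \<in> cen c"
  shows "q \<in> cen c"
proof -
  define N where "N = (2::int) ^ fst c - 1"
  have e: "N * snd (bmul q q) = snd c * (2 ^ fst (bmul q q) - 1)"
    using assms by (simp_all only: mem_cen_iff N_def)
  have "(2 ^ fst q + 1) * (N * snd q) = N * snd (bmul q q)"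
    by (simp add: bmul_def algebra_simps)
  also have "\<dots> = (2 ^ fst q + 1) * (snd c * (2 ^ fst q - 1))"
    unfolding e by (simp add: algebra_simps power_add)
  finally have "N * snd q = snd c * (2 ^ fst q - 1)"
    using zero_less_power[of "2::int" "fst q"] by (simp only: mult_cancel_left) linarith
  then show ?thesis by (simp add: mem_cen_iff N_def)
qed

section \<open>Counting products of single levels\<close>

lemma level_eq_image: "(\<And>p. p \<in> U \<Longrightarrow> fst p = m) \<Longrightarrow> U = Pair m ` snd ` U"
  by (force simp: image_iff)

lemma bprod_levels: "bprod (Pair m ` A) (Pair n ` B) = Pair (m + n) ` ((*) (2 ^ n) ` A + B)"
  unfolding bprod_def bmul_def set_plus_def by (force simp: image_iff)

lemma card_bprod_levels: "card (bprod (Pair m ` A) (Pair n ` B)) = card ((*) (2 ^ n) ` A + B)"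
  unfolding bprod_levels by (rule card_image) (simp add: inj_on_def)

lemma card_Pair_image: "card (Pair m ` A) = card A"
  by (rule card_image) (simp add: inj_on_def)

lemma card_bprod_ge:
  assumes "finite U" "finite V" "U \<noteq> {}" "V \<noteq> {}"
    and "\<And>p. p \<in> U \<Longrightarrow> fst p = m" "\<And>p. p \<in> V \<Longrightarrow> fst p = n"
  shows "card U + card V \<le> card (bprod U V) + 1"
proof -
  obtain A B where AB: "U = Pair m ` A" "V = Pair n ` B" using level_eq_image assms(5,6) by metis
  have "finite A" "finite B" using assms(1,2) unfolding AB by (auto dest!: finite_imageD simp: inj_on_def)
  then have "card ((*) (2 ^ n) ` A) + card B \<le> card ((*) (2 ^ n) ` A + B) + 1"
    using assms(3,4) AB by (intro card_sumset_ge) auto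
  moreover have "card ((*) (2 ^ n) ` A) = card A" by (rule card_image) (simp add: inj_on_def)
  ultimately show ?thesis unfolding AB card_bprod_levels card_Pair_image by simp
qed

lemma card_bprod_self_ge:
  assumes "finite U" "U \<noteq> {}" and "\<And>p. p \<in> U \<Longrightarrow> fst p = m" and m: "m \<ge> 1"
  shows "3 * card U \<le> card (bprod U U) + 2"
proof -
  obtain A where A: "U = Pair m ` A" using level_eq_image assms(3) by metis
  have "finite A" using assms(1) unfolding A by (auto dest!: finite_imageD simp: inj_on_def)
  moreover have "(2::int) ^ m \<ge> 2" using self_le_power[of "2::int" m] m by simp
  ultimately have "3 * card A \<le> card (A + (*) (2 ^ m) ` A) + 2"
    using assms(2) A by (intro card_sum_dilate_ge) auto
  then show ?thesis unfolding A card_bprod_levels card_Pair_image by (simp add: add.commute)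
qed

text \<open>Left and right multiples of \<open>U\<close> by \<open>x\<close> lie on one level. Left
  multiplication by \<open>x\<close> preserves the diameter of the second components, right
  multiplication stretches it by \<open>2 ^ fst x \<ge> 2\<close>, so the two sets of size
  \<open>card U\<close> cannot coincide.\<close>

lemma card_bprod_singleton_ge:
  assumes fin: "finite U" and U2: "card U \<ge> 2" and lev: "\<And>p. p \<in> U \<Longrightarrow> fst p = m" and x: "fst x \<ge> 1"
  shows "card U + 1 \<le> card (bprod U {x} \<union> bprod {x} U)"
proof (rule ccontr)
  assume neg: "\<not> ?thesis"
  have eq: "bprod U {x} = (\<lambda>p. bmul p x) ` U" "bprod {x} U = bmul x ` U"
    by (auto simp: bprod_def)
  have c: "card (bprod U {x}) = card U" "card (bprod {x} U) = card U"
    unfolding eq by (auto intro!: card_image inj_onI dest: bmul_left_cancel bmul_right_cancel)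
  have f: "finite (bprod U {x} \<union> bprod {x} U)" using fin by (simp add: finite_bprod)
  have "bprod U {x} = bprod U {x} \<union> bprod {x} U"
    by (rule card_seteq[OF f]) (use neg c in auto)
  moreover have "bprod {x} U = bprod U {x} \<union> bprod {x} U"
    by (rule card_seteq[OF f]) (use neg c in auto)
  ultimately have same: "bprod U {x} = bprod {x} U" by simp
  define A where "A = snd ` U"
  have A: "finite A" "A \<noteq> {}" using fin U2 by (auto simp: A_def)
  have UA: "U = Pair m ` A" unfolding A_def using lev by (rule level_eq_image)
  define a b where "a = Min A" and "b = Max A"
  have ab: "a \<in> A" "b \<in> A" "\<And>z. z \<in> A \<Longrightarrow> a \<le> z \<and> z \<le> b" using A by (auto simp: a_def b_def)
  have "a \<noteq> b"
  proof
    assume "a = b"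
    then have "A \<subseteq> {a}" using ab(3) by force
    then have "card A \<le> 1" using card_mono[of "{a}" A] by simp
    then show False using U2 unfolding UA card_Pair_image by simp
  qed
  then have "a < b" using ab by force
  have "\<exists>z\<in>A. 2 ^ fst x * w + snd x = 2 ^ m * snd x + z" if "w \<in> A" for w
  proof -
    have "bmul (m, w) x \<in> bprod {x} U" using that same UA by (auto intro: bprodI)
    then show ?thesis by (auto simp: bprod_def bmul_def UA)
  qed
  then obtain a' b' where "a' \<in> A" "b' \<in> A" "2 ^ fst x * a + snd x = 2 ^ m * snd x + a'"
    "2 ^ fst x * b + snd x = 2 ^ m * snd x + b'" using ab(1,2) by meson
  then have "2 ^ fst x * b - 2 ^ fst x * a \<le> b - a" using ab(3)[of a'] ab(3)[of b'] by linarith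
  then have "2 ^ fst x * (b - a) \<le> b - a" by (simp add: right_diff_distrib)
  moreover have "2 * (b - a) \<le> 2 ^ fst x * (b - a)"
    using self_le_power[of "2::int" "fst x"] x \<open>a < b\<close> by (intro mult_right_mono) auto
  ultimately have "2 * (b - a) \<le> b - a" by (rule order_trans[rotated])
  then show False using \<open>a < b\<close> by simp
qed

text \<open>The sets are separated by level: \<open>bprod T T\<close> reaches at most
  \<open>2 * m'\<close>, the mixed products are at \<open>m + m'\<close>, and
  \<open>bprod U U\<close> is at \<open>2 * m\<close>. \<open>E\<close> holds additional products
  below the mixed level.\<close>

lemma card_bprod_top:
  assumes fin: "finite S" and U: "U \<subseteq> S" "\<And>p. p \<in> U \<Longrightarrow> fst p = m"
    and V: "V \<subseteq> T" "\<And>p. p \<in> V \<Longrightarrow> fst p = m'"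
    and T: "T \<subseteq> S" "\<And>p. p \<in> T \<Longrightarrow> fst p \<le> m'" and m: "m' < m"
    and E: "E \<subseteq> bprod S S" "\<And>e. e \<in> E \<Longrightarrow> e \<notin> bprod T T \<and> fst e < m + m'"
  shows "card (bprod T T) + card E + card (bprod U V \<union> bprod V U) + card (bprod U U) \<le> card (bprod S S)"
proof -
  let ?N = "bprod U V \<union> bprod V U"
  have fS: "finite (bprod S S)" using fin by (simp add: finite_bprod)
  have sub: "bprod T T \<subseteq> bprod S S" "?N \<subseteq> bprod S S" "bprod U U \<subseteq> bprod S S"
    using U(1) T(1) V(1) bprod_mono[of T S T S] bprod_mono[of U S U S] bprod_mono[of U S V S]
      bprod_mono[of V S U S] by auto
  have f: "finite (bprod T T)" "finite E" "finite ?N" "finite (bprod U U)"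
    using sub E(1) fS finite_subset by blast+
  have lT: "fst z \<le> m' + m'" if "z \<in> bprod T T" for z
  proof -
    obtain p q where "p \<in> T" "q \<in> T" "z = bmul p q"
      using \<open>z \<in> bprod T T\<close> by (rule bprodE)
    then show ?thesis using T(2)[of p] T(2)[of q] by simp
  qed
  have lN: "fst z = m + m'" if "z \<in> ?N" for z
    using that
  proof
    assume "z \<in> bprod U V" then show ?thesis using U(2) V(2) by (rule fst_bprod)
  next
    assume "z \<in> bprod V U" then have "fst z = m' + m" using V(2) U(2) by (rule fst_bprod)
    then show ?thesis by simp
  qed
  have lU: "fst z = m + m" if "z \<in> bprod U U" for z
    using that U(2) U(2) by (rule fst_bprod)
  have d1: "bprod T T \<inter> E = {}" using E by auto
  have d2: "(bprod T T \<union> E) \<inter> ?N = {}"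
  proof -
    have "z \<notin> ?N" if "z \<in> bprod T T \<union> E" for z
      using that lT[of z] lN[of z] E(2)[of z] m by auto
    then show ?thesis by blast
  qed
  have d3: "(bprod T T \<union> E \<union> ?N) \<inter> bprod U U = {}"
  proof -
    have "z \<notin> bprod U U" if "z \<in> bprod T T \<union> E \<union> ?N" for z
      using that lT[of z] lN[of z] lU[of z] E(2)[of z] m by auto
    then show ?thesis by blast
  qed
  have "card (bprod T T \<union> E \<union> ?N \<union> bprod U U)
    = card (bprod T T) + card E + card ?N + card (bprod U U)"
    using f d1 d2 d3 by (simp only: card_Un_disjoint finite_Un)
  moreover have "card (bprod T T \<union> E \<union> ?N \<union> bprod U U) \<le> card (bprod S S)"
    using sub E(1) fS by (intro card_mono) auto
  ultimately show ?thesis by linarith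
qed

text \<open>On a centralizer the level is injective, so the levels of the products form a sumset of
  integers to which the elementary bound applies.\<close>

lemma card_bprod_abelian_ge:
  assumes fin: "finite T" and ne: "T \<noteq> {}" and c: "fst c \<ge> 1" and T: "T \<subseteq> cen c"
  shows "2 * card T \<le> card (bprod T T) + 1"
proof -
  let ?f = "\<lambda>p. int (fst p)"
  have inj: "inj_on ?f T"
  proof (rule inj_onI)
    fix p q assume "p \<in> T" "q \<in> T" "?f p = ?f q"
    then show "p = q" using cen_level_inj[OF c, of p q] T by auto
  qed
  have "?f ` bprod T T = ?f ` T + ?f ` T"
    by (auto simp: bprod_def set_plus_def image_iff) (metis fst_conv)+
  then have "card (?f ` T + ?f ` T) \<le> card (bprod T T)"
    using card_image_le[OF finite_bprod[OF fin fin], of ?f] by simp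
  moreover have "card (?f ` T) + card (?f ` T) \<le> card (?f ` T + ?f ` T) + 1"
    using fin ne by (intro card_sumset_ge) auto
  moreover have "card (?f ` T) = card T" using inj by (rule card_image)
  ultimately show ?thesis by linarith
qed

text \<open>
  \<open>T\<close> lies in one centralizer; its products with elements of \<open>U\<close> outside this centralizer stay
  outside and hence miss \<open>T\<^sup>2\<close>.
\<close>

lemma card_bprod_abelian_below:
  assumes fin: "finite T" "finite U" and U: "\<And>p. p \<in> U \<Longrightarrow> fst p = m" and m: "\<And>p. p \<in> T \<Longrightarrow> fst p < m"
    and c: "c \<in> T" "fst c \<ge> 1" and T: "\<And>p q. p \<in> T \<Longrightarrow> q \<in> T \<Longrightarrow> q \<in> cen p"
    and g: "g \<in> U" "g \<notin> cen c" and T3: "card T \<ge> 3"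
  shows "7 * card (T \<union> U) \<le> 2 * card (bprod (T \<union> U) (T \<union> U)) + 8"
proof -
  let ?S = "T \<union> U"
  have Tc: "T \<subseteq> cen c" using T c by blast
  have lev: "x = y" if "x \<in> T" "y \<in> T" "fst x = fst y" for x y
    using cen_level_inj[OF c(2)] Tc that by blast
  have m1: "m \<ge> 1" using m[OF c(1)] by linarith
  have TT: "2 * card T \<le> card (bprod T T) + 1"
    using card_bprod_abelian_ge[OF fin(1) _ c(2) Tc] c by blast
  have UU: "3 * card U \<le> card (bprod U U) + 2"
    using g by (intro card_bprod_self_ge[OF fin(2) _ U m1]) auto
  have cU: "card ?S = card T + card U"
    using fin U m by (intro card_Un_disjoint) fastforce+
  have TTc: "bprod T T \<subseteq> cen c"
  proof
    fix z assume "z \<in> bprod T T"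
    then obtain p q where "p \<in> T" "q \<in> T" "z = bmul p q" by (rule bprodE)
    then show "z \<in> cen c" using Tc cen_bmul by blast
  qed
  have fS: "finite (bprod ?S ?S)" using fin by (simp add: finite_bprod)
  \<comment> \<open>\<open>N\<close> misses \<open>bprod T T\<close> because that set lies in
    \<open>cen c\<close>, and misses \<open>bprod U U\<close> by level.\<close>
  have cnt: "card (bprod T T) + card N + card (bprod U U) \<le> card (bprod ?S ?S)"
    if N: "N \<subseteq> bprod T U \<union> bprod U T" "N \<inter> cen c = {}" for N
  proof -
    have sub: "bprod T T \<subseteq> bprod ?S ?S" "bprod U U \<subseteq> bprod ?S ?S" "N \<subseteq> bprod ?S ?S"
      using N(1) bprod_mono[of T ?S T ?S] bprod_mono[of U ?S U ?S] bprod_mono[of U ?S T ?S]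
        bprod_mono[of T ?S U ?S] by auto
    have f: "finite (bprod T T)" "finite (bprod U U)" "finite N" using sub fS finite_subset by blast+
    have d1: "bprod T T \<inter> N = {}" using N TTc by blast
    have "fst z < m + m" if "z \<in> bprod T T \<union> N" for z
    proof -
      have "z \<in> bprod T T \<union> bprod T U \<union> bprod U T" using that N by blast
      then obtain p q where "z = bmul p q" "p \<in> ?S" "q \<in> ?S" "p \<in> T \<or> q \<in> T"
        by (blast elim: bprodE)
      then show ?thesis using m[of p] m[of q] U[of p] U[of q] by auto
    qed
    moreover have "fst z = m + m" if "z \<in> bprod U U" for z using that U U by (rule fst_bprod)
    ultimately have d2: "(bprod T T \<union> N) \<inter> bprod U U = {}" by fastforce
    have "card (bprod T T \<union> N \<union> bprod U U) = card (bprod T T) + card N + card (bprod U U)"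
      using f d1 d2 by (simp only: card_Un_disjoint finite_Un)
    moreover have "card (bprod T T \<union> N \<union> bprod U U) \<le> card (bprod ?S ?S)"
      using sub fS by (intro card_mono) auto
    ultimately show ?thesis by linarith
  qed
  show ?thesis
  proof (cases "card U \<le> card T")
    case True
    let ?P = "bmul g ` T" and ?Q = "(\<lambda>t. bmul t g) ` T"
    have "?P \<union> ?Q \<subseteq> bprod T U \<union> bprod U T" using g by (auto intro: bprodI)
    moreover have "bmul g t \<notin> cen c \<and> bmul t g \<notin> cen c" if "t \<in> T" for t
      using cen_bmul_right[of t c g] cen_bmul_left[of t c g] that g Tc by blast
    then have "(?P \<union> ?Q) \<inter> cen c = {}" by blast
    ultimately have N: "card (bprod T T) + card (?P \<union> ?Q) + card (bprod U U) \<le> card (bprod ?S ?S)"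
      by (rule cnt)
    \<comment> \<open>From \<open>bmul g t = bmul t' g\<close> the levels give
      \<open>t = t'\<close>, so \<open>g\<close> commutes with \<open>t\<close>. At positive level
      \<open>t\<close> would then force \<open>g\<close> to commute with \<open>c\<close>; so
      \<open>t\<close> has level 0, where \<open>T\<close> has at most one element.\<close>
    have "z = w" if zw: "z \<in> ?P \<inter> ?Q" "w \<in> ?P \<inter> ?Q" for z w
    proof -
      have *: "\<exists>t\<in>T. fst t = 0 \<and> y = bmul g t" if y: "y \<in> ?P \<inter> ?Q" for y
      proof -
        obtain t t' where t: "t \<in> T" "t' \<in> T" "y = bmul g t" "y = bmul t' g" using y by blast
        then have "fst g + fst t = fst t' + fst g" by (metis fst_bmul)
        then have "t = t'" using lev t by simp
        then have gt: "g \<in> cen t" using t by (simp add: cen_def)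
        have "c \<in> cen t" using T t c by blast
        then have "fst t = 0" using cen_commute[of t c g] gt g(2) by fastforce
        then show ?thesis using t by blast
      qed
      show ?thesis using *[OF zw(1)] *[OF zw(2)] lev by metis
    qed
    moreover have "finite (?P \<inter> ?Q)" using fin by simp
    ultimately have "card (?P \<inter> ?Q) \<le> 1" unfolding One_nat_def by (subst card_le_Suc0_iff_eq) blast+
    moreover have "card ?P = card T" "card ?Q = card T"
      by (auto intro!: card_image inj_onI dest: bmul_left_cancel bmul_right_cancel)
    moreover have "card ?P + card ?Q = card (?P \<union> ?Q) + card (?P \<inter> ?Q)"
      using fin by (intro card_Un_Int) auto
    ultimately show ?thesis using N TT UU True cU by simp
  next
    case False
    define D where "D = U - cen c"
    \<comment> \<open>All of \<open>D\<close> is on level \<open>m\<close>, so the level of a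
      product determines its factor in \<open>T\<close>, and then cancellation determines the other
      factor.\<close>
    have "card (bprod D T) = card D * card T"
    proof -
      have "inj_on (\<lambda>(p, q). bmul p q) (D \<times> T)"
      proof (rule inj_onI, clarsimp simp only: mem_Sigma_iff prod.case split_paired_all prod.inject)
        fix d1 d2 t1 t2 d1' d2' t1' t2'
        assume h: "(d1, d2) \<in> D" "(t1, t2) \<in> T" "(d1', d2') \<in> D" "(t1', t2') \<in> T"
          "bmul (d1, d2) (t1, t2) = bmul (d1', d2') (t1', t2')"
        have "d1 = m" "d1' = m" using h(1,3) U by (force simp: D_def)+
        then have "t1 = t1'" using h(5) by (simp add: bmul_def)
        then have "(t1, t2) = (t1', t2')" using lev[OF h(2,4)] by simp
        then show "((d1 = d1' \<and> d2 = d2') \<and> t1 = t1' \<and> t2 = t2')"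
          using h(5) bmul_right_cancel by blast
      qed
      then show ?thesis unfolding bprod_def by (simp add: card_image card_cartesian_product)
    qed
    moreover have "bprod D T \<inter> cen c = {}"
    proof -
      have "z \<notin> cen c" if "z \<in> bprod D T" for z
        using that
      proof (rule bprodE)
        fix p q assume "p \<in> D" "q \<in> T" "z = bmul p q"
        then show ?thesis using cen_bmul_right[of q c p] Tc by (auto simp: D_def)
      qed
      then show ?thesis by blast
    qed
    moreover have "bprod D T \<subseteq> bprod T U \<union> bprod U T" using bprod_mono[of D U T T] by (auto simp: D_def)
    ultimately have N: "card (bprod T T) + card D * card T + card (bprod U U) \<le> card (bprod ?S ?S)"
      using cnt[of "bprod D T"] by simp
    have "p = q" if "p \<in> U \<inter> cen c" "q \<in> U \<inter> cen c" for p q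
      using cen_level_inj[OF c(2), of p q] U[of p] U[of q] that by simp
    moreover have "finite (U \<inter> cen c)" using fin by simp
    ultimately have "card (U \<inter> cen c) \<le> 1" unfolding One_nat_def by (subst card_le_Suc0_iff_eq) blast+
    moreover have "card U = card D + card (U \<inter> cen c)"
      unfolding D_def using fin by (metis add.commute card_Int_Diff)
    ultimately have "card U \<le> card D + 1" by linarith
    then have "3 \<le> card D" using False T3 by linarith
    then obtain i j where ij: "card D = i + 3" "card T = j + 3"
      using T3 by (metis add.commute le_Suc_ex)
    have "card D * card T = i * j + 3 * i + 3 * j + 9" unfolding ij by (simp add: algebra_simps)
    \<comment> \<open>This is \<open>(card D - 3) * (card T - 3) \<ge> 0\<close>, linearising the
      product count.\<close>
    then have "3 * card D + 3 * card T \<le> card D * card T + 9" using ij by simp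
    then show ?thesis using N TT UU cU \<open>card U \<le> card D + 1\<close> ij False by linarith
  qed
qed

section \<open>Sets meeting several levels\<close>

lemma card_bprod_multi_level:
  assumes "finite S" "card (fst ` S) \<ge> 2"
    and "card (fst ` S) = 2 \<or> (\<exists>p\<in>S. \<exists>q\<in>S. q \<notin> cen p)"
  shows "7 * card S \<le> 2 * card (bprod S S) + 8"
  using assms
proof (induction "card S" arbitrary: S rule: less_induct)
  case less
  note fin = less.prems(1)
  define m where "m = Max (fst ` S)"
  define U where "U = {p \<in> S. fst p = m}"
  define T where "T = {p \<in> S. fst p \<noteq> m}"
  define m' where "m' = Max (fst ` T)"
  define V where "V = {p \<in> T. fst p = m'}"
  have S0: "S \<noteq> {}" using less.prems(2) by auto
  have fU: "finite U" and fT: "finite T" and fV: "finite V" using fin by (auto simp: U_def T_def V_def)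
  have mS: "fst p \<le> m" if "p \<in> S" for p using that fin by (auto simp: m_def)
  have mem: "m \<in> fst ` S" using fin S0 by (auto simp: m_def)
  then have U0: "U \<noteq> {}" by (auto simp: U_def)
  have SU: "S = T \<union> U" by (auto simp: T_def U_def)
  have cS: "card S = card T + card U"
    unfolding SU using fT fU by (intro card_Un_disjoint) (auto simp: T_def U_def)
  have imT: "fst ` S = insert m (fst ` T)" "m \<notin> fst ` T" using mem by (auto simp: T_def)
  then have cM: "card (fst ` S) = Suc (card (fst ` T))" using fT by simp
  then have T0: "T \<noteq> {}" using less.prems(2) by auto
  have Tlt: "fst p < m" if "p \<in> T" for p using that mS[of p] by (auto simp: T_def)
  have m'T: "m' \<in> fst ` T" using fT T0 by (auto simp: m'_def)
  have Tle: "fst p \<le> m'" if "p \<in> T" for p using that fT by (auto simp: m'_def)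
  have mm: "m' < m" using m'T Tlt by auto
  have V0: "V \<noteq> {}" using m'T by (auto simp: V_def)
  have Ulev: "fst p = m" if "p \<in> U" for p using that by (simp add: U_def)
  have Vlev: "fst p = m'" if "p \<in> V" for p using that by (simp add: V_def)
  have sub: "U \<subseteq> S" "V \<subseteq> T" "T \<subseteq> S" by (auto simp: U_def V_def T_def)
  have top: "card (bprod T T) + card E + card (bprod U V \<union> bprod V U) + card (bprod U U) \<le> card (bprod S S)"
    if "E \<subseteq> bprod S S" "\<And>e. e \<in> E \<Longrightarrow> e \<notin> bprod T T \<and> fst e < m + m'" for E
    by (rule card_bprod_top[OF fin sub(1) Ulev sub(2) Vlev sub(3) Tle mm that])
  from top[of "{}"] have top0:
    "card (bprod T T) + card (bprod U V \<union> bprod V U) + card (bprod U U) \<le> card (bprod S S)"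
    by simp
  have UU: "3 * card U \<le> card (bprod U U) + 2"
    using card_bprod_self_ge[OF fU U0 Ulev] mm by simp
  have fN: "finite (bprod U V \<union> bprod V U)" using fU fV by (simp add: finite_bprod)
  have UV: "card U + card V \<le> card (bprod U V \<union> bprod V U) + 1"
  proof -
    have "card (bprod U V) \<le> card (bprod U V \<union> bprod V U)" using fN by (intro card_mono) auto
    then show ?thesis using card_bprod_ge[OF fU fV U0 V0 Ulev Vlev] by linarith
  qed
  have pos: "card U \<ge> 1" "card V \<ge> 1" using U0 V0 fU fV by (simp_all add: Suc_le_eq card_gt_0_iff)
  show ?case
  proof (cases "card (fst ` S) = 2")
    case True
    then have "card (fst ` T) = 1" using cM by simp
    then have fT1: "fst ` T = {m'}" using m'T by (metis card_1_singletonE singletonD)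
    have "fst p = m'" if "p \<in> T" for p using imageI[OF that, of fst] unfolding fT1 by simp
    then have TV: "T = V" by (auto simp: V_def)
    show ?thesis
    proof (cases "m' = 0")
      case False
      then have "3 * card V \<le> card (bprod V V) + 2"
        using card_bprod_self_ge[OF fV V0 Vlev] by simp
      then show ?thesis using top0 UU UV cS pos unfolding TV by linarith
    next
      case True
      define A B where "A = snd ` V" and "B = snd ` U"
      have V: "V = Pair 0 ` A" unfolding A_def using level_eq_image[of V m'] Vlev True by blast
      have U: "U = Pair m ` B" unfolding B_def using Ulev by (rule level_eq_image)
      have fAB: "finite A" "finite B" "A \<noteq> {}" "B \<noteq> {}" using fU fV U0 V0 by (auto simp: A_def B_def)
      have "7 * card A + card B \<le> 2 * card (A + A) + 2 * card ((A + B) \<union> ((*) (2 ^ m) ` A + B)) + 4"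
        using mm by (intro card_bottom_levels[OF fAB]) auto
      moreover have "card (bprod V V) = card (A + A)" unfolding V card_bprod_levels by simp
      moreover have "bprod U V \<union> bprod V U = Pair m ` ((A + B) \<union> ((*) (2 ^ m) ` A + B))"
        unfolding U V bprod_levels image_Un by (simp add: add.commute)
      moreover have "card A = card V" "card B = card U" unfolding U V by (simp_all add: card_Pair_image)
      ultimately show ?thesis using top0 UU cS unfolding TV by (simp add: card_Pair_image)
    qed
  next
    case False
    then have M3: "card (fst ` T) \<ge> 2" using cM less.prems(2) by linarith
    have nonab: "\<exists>p\<in>S. \<exists>q\<in>S. q \<notin> cen p" using less.prems(3) False by blast
    have ex_other: "\<exists>z\<in>T. fst z \<noteq> m'"
    proof (rule ccontr)
      assume "\<not> ?thesis"
      then have "fst ` T \<subseteq> {m'}" by auto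
      then have "card (fst ` T) \<le> 1" using card_mono[of "{m'}" "fst ` T"] by simp
      then show False using M3 by simp
    qed
    then have m'1: "m' \<ge> 1" using Tle by fastforce
    show ?thesis
    proof (cases "card (fst ` T) = 2 \<or> (\<exists>p\<in>T. \<exists>q\<in>T. q \<notin> cen p)")
      case False
      then have Tab: "\<And>p q. p \<in> T \<Longrightarrow> q \<in> T \<Longrightarrow> q \<in> cen p" by blast
      obtain c where c: "c \<in> T" "fst c = m'" using m'T by auto
      \<comment> \<open>Otherwise all of \<open>S\<close> would lie in the centralizer of an element
        of positive level, which is abelian.\<close>
      have "\<exists>g\<in>U. g \<notin> cen c"
      proof (rule ccontr)
        assume "\<not> ?thesis"
        then have "S \<subseteq> cen c" using Tab c(1) SU by blast
        then show False using nonab cen_commute[of c] c(2) m'1 by blast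
      qed
      then obtain g where g: "g \<in> U" "g \<notin> cen c" by blast
      have "card (fst ` T) \<le> card T" using fT by (rule card_image_le)
      then have "3 \<le> card T" using M3 False by linarith
      then show ?thesis
        using card_bprod_abelian_below[OF fT fU Ulev Tlt c(1) _ Tab g] c(2) m'1 SU by simp
    next
      case True
      have "card T < card S" using cS pos by simp
      then have IH: "7 * card T \<le> 2 * card (bprod T T) + 8" using less.hyps[OF _ fT M3 True] by blast
      show ?thesis
      proof (cases "card U = 1 \<and> card V = 1")
        case False
        consider "card U \<ge> 2" "card V \<ge> 2" | "card U \<ge> 2" "card V = 1" | "card U = 1" "card V \<ge> 2"
          using False pos by linarith
        then show ?thesis
        proof cases
          case 1
          then show ?thesis using IH top0 UU UV cS by linarith
        next
          case 2
          then obtain x where x: "V = {x}" by (auto simp: card_1_singleton_iff)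
          then have "card U + 1 \<le> card (bprod U V \<union> bprod V U)"
            using card_bprod_singleton_ge[OF fU 2(1) Ulev, of x] Vlev[of x] m'1 by simp
          then show ?thesis using IH top0 UU cS 2 by linarith
        next
          case 3
          then obtain x where x: "U = {x}" by (auto simp: card_1_singleton_iff)
          then have "card V + 1 \<le> card (bprod V U \<union> bprod U V)"
            using card_bprod_singleton_ge[OF fV 3(2) Vlev, of x] Ulev[of x] mm by simp
          then show ?thesis using IH top0 UU cS 3 by (simp add: Un_commute)
        qed
      next
        case True
        then obtain x y where xy: "U = {x}" "V = {y}" by (auto simp: card_1_singleton_iff)
        have x: "x \<in> S" "fst x = m" and y: "y \<in> T" "fst y = m'"
          using xy sub Ulev[of x] Vlev[of y] by auto
        have Veq: "q = y" if "q \<in> T" "fst q = m'" for q using that xy by (auto simp: V_def)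
        have N: "bprod U V \<union> bprod V U = {bmul x y, bmul y x}" by (auto simp: xy bprod_def)
        \<comment> \<open>Four new products are needed for a singleton top level; the summand 1
          stands for the square of \<open>x\<close>.\<close>
        have goal: ?thesis if "4 \<le> card E + card (bprod U V \<union> bprod V U) + 1"
          "E \<subseteq> bprod S S" "\<And>e. e \<in> E \<Longrightarrow> e \<notin> bprod T T \<and> fst e < m + m'" for E
          using top[OF that(2,3)] that(1) IH UU cS True by linarith
        show ?thesis
        proof (cases "y \<in> cen x")
          case False
          then have N2: "card (bprod U V \<union> bprod V U) = 2" unfolding N by (simp add: cen_def)
          define m2 where "m2 = Max (fst ` (T - V))"
          have TV0: "T - V \<noteq> {}" using ex_other by (auto simp: V_def)
          have "m2 \<in> fst ` (T - V)" using fT TV0 by (auto simp: m2_def)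
          then obtain z where z: "z \<in> T" "fst z = m2" "z \<notin> V" by auto
          have m2: "m2 < m'" using Tle[OF z(1)] z by (auto simp: V_def)
          have TVle: "fst q \<le> m2" if "q \<in> T" "q \<noteq> y" for q
            using that fT by (auto simp: m2_def xy)
          \<comment> \<open>\<open>z\<close> is on the second highest level of \<open>T\<close>, so
            the only product of two elements of \<open>T\<close> that can share the level of
            \<open>e\<close> is the square of \<open>y\<close>. If \<open>z\<close> commutes with
            \<open>x\<close>, that square is avoided because it lies outside
            \<open>cen x\<close>.\<close>
          have "\<exists>e\<in>{bmul z x, bmul x z}. e \<noteq> bmul y y"
          proof (cases "z \<in> cen x")
            case True
            have "x \<in> cen x" by (simp add: cen_def)
            then have "bmul z x \<in> cen x" using True cen_bmul by blast
            then have "bmul z x \<noteq> bmul y y" using False cen_square by metis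
            then show ?thesis by blast
          next
            case False
            then show ?thesis by (auto simp: cen_def)
          qed
          then obtain e where e: "e = bmul z x \<or> e = bmul x z" "e \<noteq> bmul y y" by blast
          have fe: "fst e = m + m2" using e(1) x z by auto
          have eT: "e \<notin> bprod T T"
          proof
            assume "e \<in> bprod T T"
            then obtain p q where pq: "p \<in> T" "q \<in> T" "e = bmul p q" by (rule bprodE)
            have s: "fst p + fst q = m + m2" using fe pq by simp
            have "q = y" using TVle[OF pq(2)] Tlt[OF pq(1)] s by force
            moreover have "p = y" using TVle[OF pq(1)] Tlt[OF pq(2)] s by force
            ultimately show False using e(2) pq(3) by simp
          qed
          have "e \<in> bprod S S" using e(1) x z sub by (auto intro: bprodI)
          then show ?thesis using goal[of "{e}"] N2 eT fe m2 by simp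
        next
          case True
          define Z where "Z = {z \<in> S. z \<notin> cen x}"
          have x1: "fst x \<ge> 1" using x mm by simp
          have Z0: "Z \<noteq> {}"
          proof
            assume "Z = {}"
            then have "S \<subseteq> cen x" by (auto simp: Z_def)
            then show False using nonab cen_commute[OF x1] by blast
          qed
          have fZ: "finite Z" using fin by (simp add: Z_def)
          have "Max (fst ` Z) \<in> fst ` Z" using fZ Z0 by simp
          \<comment> \<open>\<open>z\<close> is chosen of highest level outside
            \<open>cen x\<close>. A factorisation of \<open>bmul z x\<close> or
            \<open>bmul x z\<close> within \<open>T\<close> would have both factors above the level
            of \<open>z\<close>, hence in \<open>cen x\<close>, which is impossible.\<close>
          then obtain z where z: "z \<in> Z" "fst z = Max (fst ` Z)" by auto
          have zmax: "q \<in> cen x" if "q \<in> S" "fst z < fst q" for q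
          proof (rule ccontr)
            assume "q \<notin> cen x"
            then have "fst q \<le> fst z" using that(1) z(2) fZ by (auto simp: Z_def)
            then show False using that(2) by simp
          qed
          have zx: "z \<in> S" "z \<notin> cen x" using z by (auto simp: Z_def)
          have "x \<in> cen x" by (simp add: cen_def)
          have zT: "z \<in> T" using zx \<open>x \<in> cen x\<close> SU xy by blast
          have zm: "fst z < m'" using Tle[OF zT] Veq[OF zT] True zx(2) by force
          let ?E = "{bmul z x, bmul x z}"
          have "card ?E = 2" using zx(2) by (auto simp: cen_def)
          moreover have "card (bprod U V \<union> bprod V U) \<ge> 1" unfolding N by (simp add: Suc_le_eq card_gt_0_iff)
          moreover have "?E \<subseteq> bprod S S" using zx x by (auto intro: bprodI)
          moreover have "e \<notin> bprod T T \<and> fst e < m + m'" if "e \<in> ?E" for e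
          proof
            show "fst e < m + m'" using that x zm by auto
            have fe: "fst e = m + fst z" using that x by auto
            have ec: "e \<notin> cen x" using that zx(2) \<open>x \<in> cen x\<close> cen_bmul_left cen_bmul_right by blast
            show "e \<notin> bprod T T"
            proof
              assume "e \<in> bprod T T"
              then obtain p q where pq: "p \<in> T" "q \<in> T" "e = bmul p q" by (rule bprodE)
              have s: "fst p + fst q = m + fst z" using fe pq by simp
              have "p \<in> cen x" using zmax[of p] sub pq Tlt[OF pq(2)] s by force
              moreover have "q \<in> cen x" using zmax[of q] sub pq Tlt[OF pq(1)] s by force
              ultimately show False using ec pq(3) cen_bmul by blast
            qed
          qed
          ultimately show ?thesis using goal[of ?E] by simp
        qed
      qed
    qed
  qed
qed

text \<open>Several levels, or a single level at least 2, both give \<open>7k/2 - 4\<close>; level 0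
  is abelian. So a smaller square forces level 1, where the product set is a copy of
  \<open>A + 2A\<close>.\<close>

lemma card_bprod_nonabelian:
  assumes fin: "finite S" and nonab: "p \<in> S" "q \<in> S" "q \<notin> cen p"
  shows "3 * card S \<le> card (bprod S S) + 2"
    and "2 * card (bprod S S) + 8 < 7 * card S \<Longrightarrow>
      \<exists>A. finite A \<and> S = Pair 1 ` A \<and> card (bprod S S) = card (A + (*) 2 ` A)"
proof -
  have S0: "S \<noteq> {}" using nonab by blast
  have pq: "p \<noteq> q" using nonab by (auto simp: cen_def)
  have "{p, q} \<subseteq> S" using nonab by blast
  then have k2: "card S \<ge> 2" using card_mono[OF fin, of "{p, q}"] pq by simp
  have "3 * card S \<le> card (bprod S S) + 2 \<and> (2 * card (bprod S S) + 8 < 7 * card S \<longrightarrow>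
      (\<exists>A. finite A \<and> S = Pair 1 ` A \<and> card (bprod S S) = card (A + (*) 2 ` A)))"
  proof (cases "card (fst ` S) \<ge> 2")
    case True
    then have main: "7 * card S \<le> 2 * card (bprod S S) + 8"
      using nonab by (intro card_bprod_multi_level fin) blast+
    moreover have "3 * card S \<le> card (bprod S S) + 2"
    \<comment> \<open>By integrality \<open>7k/2 - 4\<close> gives \<open>3k - 2\<close> for
      \<open>k \<ge> 3\<close>. For \<open>k = 2\<close> it gives only 3, and the four products are
      listed explicitly.\<close>
    proof (cases "card S = 2")
      case True
      then have S: "S = {p, q}" using \<open>{p, q} \<subseteq> S\<close> pq fin by (metis card_subset_eq card_2_iff)
      then have lev: "fst p \<noteq> fst q" using \<open>2 \<le> card (fst ` S)\<close> by auto
      have "bmul p q \<noteq> bmul q p" using nonab(3) by (auto simp: cen_def)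
      moreover have "fst (bmul p p) \<noteq> fst (bmul p q)" "fst (bmul p p) \<noteq> fst (bmul q p)"
        "fst (bmul p p) \<noteq> fst (bmul q q)" "fst (bmul p q) \<noteq> fst (bmul q q)"
        "fst (bmul q p) \<noteq> fst (bmul q q)" using lev by simp_all
      then have "bmul p p \<noteq> bmul p q" "bmul p p \<noteq> bmul q p" "bmul p p \<noteq> bmul q q"
        "bmul p q \<noteq> bmul q q" "bmul q p \<noteq> bmul q q" by metis+
      ultimately have "card {bmul p p, bmul p q, bmul q p, bmul q q} = 4" by simp
      moreover have "{bmul p p, bmul p q, bmul q p, bmul q q} \<subseteq> bprod S S"
        using nonab by (auto intro: bprodI)
      ultimately have "4 \<le> card (bprod S S)" using card_mono[OF finite_bprod[OF fin fin]] by metis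
      then show ?thesis using True by simp
    next
      case False
      then show ?thesis using main k2 by linarith
    qed
    ultimately show ?thesis by simp
  next
    case False
    define m where "m = fst p"
    have lev: "fst z = m" if "z \<in> S" for z
    proof (rule ccontr)
      assume "fst z \<noteq> m"
      then have "card {fst z, m} \<le> card (fst ` S)" using that nonab(1) fin by (intro card_mono) (auto simp: m_def)
      then show False using False \<open>fst z \<noteq> m\<close> by simp
    qed
    define A where "A = snd ` S"
    have SA: "S = Pair m ` A" unfolding A_def using lev by (rule level_eq_image)
    have fA: "finite A" using fin by (simp add: A_def)
    have cA: "card S = card A" unfolding SA by (rule card_Pair_image)
    have cSS: "card (bprod S S) = card (A + (*) (2 ^ m) ` A)"
      unfolding SA card_bprod_levels by (simp add: add.commute)
    have "m \<noteq> 0"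
    proof
      assume "m = 0"
      then have "q \<in> cen p" using lev[OF nonab(1)] lev[OF nonab(2)] by (simp add: mem_cen_iff)
      then show False using nonab(3) by simp
    qed
    then have m1: "m \<ge> 1" by simp
    have r2: "(2::int) ^ m \<ge> 2" using self_le_power[of "2::int" m] m1 by simp
    have "3 * card S \<le> card (bprod S S) + 2"
      unfolding cA cSS using S0 by (intro card_sum_dilate_ge[OF fA _ r2]) (auto simp: A_def)
    have "m = 1" if "2 * card (bprod S S) + 8 < 7 * card S"
    proof (rule ccontr)
      assume "m \<noteq> 1"
      then obtain n where "m = Suc (Suc n)" using m1 by (metis One_nat_def Suc_le_D not0_implies_Suc)
      then have "(2::int) ^ m \<ge> 4" by simp
      then have "7 * card A \<le> 2 * card (A + (*) (2 ^ m) ` A) + 8"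
        using card_sum_dilate_ge4[OF fA] k2 cA by simp
      then show False using that cA cSS by simp
    qed
    then have "finite A \<and> S = Pair 1 ` A \<and> card (bprod S S) = card (A + (*) 2 ` A)"
      if "2 * card (bprod S S) + 8 < 7 * card S"
      using that fA SA cSS power_one_right[of "2::int"] by metis
    with \<open>3 * card S \<le> card (bprod S S) + 2\<close> show ?thesis by blast
  qed
  then show "3 * card S \<le> card (bprod S S) + 2"
    and "2 * card (bprod S S) + 8 < 7 * card S \<Longrightarrow>
      \<exists>A. finite A \<and> S = Pair 1 ` A \<and> card (bprod S S) = card (A + (*) 2 ` A)" by blast+
qed

section \<open>Transfer to the Baumslag--Solitar group\<close>

text \<open>Translation by 1 and doubling satisfy the defining relation when the left letter acts
  first. Rationals make doubling invertible. The action serves to separate normal forms.\<close>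

fun letter_act :: "bs_gen \<times> bool \<Rightarrow> rat \<Rightarrow> rat" where
  "letter_act (GenA, True) z = z + 1"
| "letter_act (GenA, False) z = z - 1"
| "letter_act (GenB, True) z = 2 * z"
| "letter_act (GenB, False) z = z / 2"

definition word_act :: "bs_gen word \<Rightarrow> rat \<Rightarrow> rat" where
  "word_act w z = fold letter_act w z"

lemma word_act_append: "word_act (u @ v) z = word_act v (word_act u z)"
  by (simp add: word_act_def)

lemma word_act_pres_eq: "pres_eq bs_rels u v \<Longrightarrow> word_act u z = word_act v z"
proof (induction arbitrary: z rule: pres_eq.induct)
  case (cancel g e)
  then show ?case by (cases g; cases e) (simp_all add: word_act_def)
next
  case (rel u v)
  then show ?case by (auto simp: word_act_def bs_rels_def)
qed (simp_all add: word_act_append)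

definition class_act :: "bs_gen word set \<Rightarrow> rat \<Rightarrow> rat" where
  "class_act X z = word_act (SOME u. u \<in> X) z"

lemma class_act_class: "class_act (pres_class bs_rels u) z = word_act u z"
proof -
  have "u \<in> pres_class bs_rels u" by (simp add: pres_class_def pres_eq.refl)
  then have "(SOME v. v \<in> pres_class bs_rels u) \<in> pres_class bs_rels u" by (rule someI)
  then show ?thesis using word_act_pres_eq by (simp add: class_act_def pres_class_def)
qed

interpretation BS: group BS12 by (rule group_BS12)

lemma class_act_mult:
  assumes "X \<in> carrier BS12" "Y \<in> carrier BS12"
  shows "class_act (X \<otimes>\<^bsub>BS12\<^esub> Y) z = class_act Y (class_act X z)"
proof -
  obtain u v where uv: "X = pres_class bs_rels u" "Y = pres_class bs_rels v"
    using assms by (auto simp: BS12_def carrier_presented_group)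
  then have "X \<otimes>\<^bsub>BS12\<^esub> Y = pres_class bs_rels (u @ v)"
    by (simp add: BS12_def mult_presented_group)
  then show ?thesis by (simp add: uv class_act_class word_act_append)
qed

lemma class_act_one: "class_act \<one>\<^bsub>BS12\<^esub> z = z"
  by (simp add: BS12_def one_presented_group class_act_class) (simp add: word_act_def)

lemmas bs_a_carrier = BS12_generators(1)
lemmas bs_b_carrier = BS12_generators(2)

lemma class_act_a_nat: "class_act (bs_a [^]\<^bsub>BS12\<^esub> (n::nat)) z = z + of_nat n"
proof (induction n)
  case 0
  then show ?case by (simp add: class_act_one)
next
  case (Suc n)
  have "class_act bs_a y = y + 1" for y by (simp add: bs_a_def class_act_class word_act_def)
  then show ?case using Suc by (simp add: class_act_mult bs_a_carrier)
qed

lemma class_act_a: "class_act (bs_a [^]\<^bsub>BS12\<^esub> (x::int)) z = z + of_int x"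
proof (cases "x \<ge> 0")
  case True
  then have "bs_a [^]\<^bsub>BS12\<^esub> x = bs_a [^]\<^bsub>BS12\<^esub> nat x"
    by (metis int_nat_eq int_pow_int)
  then have "class_act (bs_a [^]\<^bsub>BS12\<^esub> x) z = z + of_nat (nat x)"
    by (simp only: class_act_a_nat)
  then show ?thesis using True by simp
next
  case False
  let ?n = "nat (- x)"
  have x: "x = - int ?n" using False by simp
  have "bs_a [^]\<^bsub>BS12\<^esub> x \<otimes>\<^bsub>BS12\<^esub> bs_a [^]\<^bsub>BS12\<^esub> ?n = \<one>\<^bsub>BS12\<^esub>"
    by (metis BS.int_pow_closed BS.int_pow_neg BS.l_inv bs_a_carrier int_pow_int x)
  then have "class_act (bs_a [^]\<^bsub>BS12\<^esub> x \<otimes>\<^bsub>BS12\<^esub> bs_a [^]\<^bsub>BS12\<^esub> ?n) z = z"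
    by (simp add: class_act_one)
  then have "class_act (bs_a [^]\<^bsub>BS12\<^esub> x) z + of_nat ?n = z"
    by (simp add: class_act_mult class_act_a_nat bs_a_carrier)
  moreover have "of_int x = - (of_nat ?n :: rat)" using False by simp
  ultimately show ?thesis by linarith
qed

lemma class_act_b: "class_act (bs_b [^]\<^bsub>BS12\<^esub> (n::nat)) z = 2 ^ n * z"
proof (induction n)
  case 0
  then show ?case by (simp add: class_act_one)
next
  case (Suc n)
  have "class_act bs_b y = 2 * y" for y by (simp add: bs_b_def class_act_class word_act_def)
  then show ?case using Suc by (simp add: class_act_mult bs_b_carrier)
qed

definition bs_elem :: "nat \<times> int \<Rightarrow> bs_gen word set" where
  "bs_elem p = bs_b [^]\<^bsub>BS12\<^esub> fst p \<otimes>\<^bsub>BS12\<^esub> bs_a [^]\<^bsub>BS12\<^esub> snd p"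

lemma bs_elem_carrier: "bs_elem p \<in> carrier BS12"
  by (simp add: bs_elem_def bs_a_carrier bs_b_carrier)

lemma class_act_bs_elem: "class_act (bs_elem p) z = 2 ^ fst p * z + of_int (snd p)"
  by (simp add: bs_elem_def class_act_mult class_act_a class_act_b bs_a_carrier bs_b_carrier)

text \<open>Evaluating the affine maps at 0 and at 1 recovers \<open>snd p\<close> and then
  \<open>2 ^ fst p\<close>.\<close>

lemma inj_bs_elem: "inj bs_elem"
proof (rule injI)
  fix p q assume "bs_elem p = bs_elem q"
  then have e: "2 ^ fst p * z + of_int (snd p) = 2 ^ fst q * z + (of_int (snd q) :: rat)" for z
    by (metis class_act_bs_elem)
  from e[of 0] e[of 1] show "p = q" by (simp add: prod_eq_iff)
qed

section \<open>Multiplication of normal forms\<close>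

lemma a_nat_b: "bs_a [^]\<^bsub>BS12\<^esub> (n::nat) \<otimes>\<^bsub>BS12\<^esub> bs_b = bs_b \<otimes>\<^bsub>BS12\<^esub> bs_a [^]\<^bsub>BS12\<^esub> (2 * n)"
proof (induction n)
  case 0
  then show ?case by (simp add: bs_b_carrier)
next
  case (Suc n)
  note c = bs_a_carrier bs_b_carrier
  have "bs_a [^]\<^bsub>BS12\<^esub> Suc n \<otimes>\<^bsub>BS12\<^esub> bs_b = bs_a [^]\<^bsub>BS12\<^esub> n \<otimes>\<^bsub>BS12\<^esub> (bs_a \<otimes>\<^bsub>BS12\<^esub> bs_b)"
    by (simp add: c BS.m_assoc)
  also have "\<dots> = (bs_a [^]\<^bsub>BS12\<^esub> n \<otimes>\<^bsub>BS12\<^esub> bs_b) \<otimes>\<^bsub>BS12\<^esub> bs_a [^]\<^bsub>BS12\<^esub> (2::nat)"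
    unfolding BS12_relation by (simp add: c BS.m_assoc)
  also have "\<dots> = bs_b \<otimes>\<^bsub>BS12\<^esub> (bs_a [^]\<^bsub>BS12\<^esub> (2 * n) \<otimes>\<^bsub>BS12\<^esub> bs_a [^]\<^bsub>BS12\<^esub> (2::nat))"
    unfolding Suc by (simp add: c BS.m_assoc)
  also have "\<dots> = bs_b \<otimes>\<^bsub>BS12\<^esub> bs_a [^]\<^bsub>BS12\<^esub> (2 * Suc n)"
    by (simp only: BS.nat_pow_mult[OF c(1)]) (simp add: add.commute)
  finally show ?case .
qed

lemma a_int_b: "bs_a [^]\<^bsub>BS12\<^esub> (x::int) \<otimes>\<^bsub>BS12\<^esub> bs_b = bs_b \<otimes>\<^bsub>BS12\<^esub> bs_a [^]\<^bsub>BS12\<^esub> (2 * x)"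
proof (cases "x \<ge> 0")
  case True
  then have "x = int (nat x)" "2 * x = int (2 * nat x)" by simp_all
  then show ?thesis using a_nat_b[of "nat x"] by (metis int_pow_int)
next
  case False
  define n where "n = nat (- x)"
  have x: "x = - int n" "2 * x = - int (2 * n)" using False by (simp_all add: n_def)
  note c = bs_a_carrier bs_b_carrier
  let ?an = "bs_a [^]\<^bsub>BS12\<^esub> n" and ?a2 = "bs_a [^]\<^bsub>BS12\<^esub> (2 * n)"
  have "inv\<^bsub>BS12\<^esub> ?an \<otimes>\<^bsub>BS12\<^esub> bs_b = inv\<^bsub>BS12\<^esub> ?an \<otimes>\<^bsub>BS12\<^esub> (bs_b \<otimes>\<^bsub>BS12\<^esub> ?a2) \<otimes>\<^bsub>BS12\<^esub> inv\<^bsub>BS12\<^esub> ?a2"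
    by (simp add: c BS.m_assoc)
  also have "\<dots> = bs_b \<otimes>\<^bsub>BS12\<^esub> inv\<^bsub>BS12\<^esub> ?a2"
    unfolding a_nat_b[symmetric] by (simp add: c BS.m_assoc[symmetric])
  also have "inv\<^bsub>BS12\<^esub> ?an = bs_a [^]\<^bsub>BS12\<^esub> x"
    unfolding x(1) BS.int_pow_neg[OF c(1)] int_pow_int ..
  also have "inv\<^bsub>BS12\<^esub> ?a2 = bs_a [^]\<^bsub>BS12\<^esub> (2 * x)"
    unfolding x(2) BS.int_pow_neg[OF c(1)] int_pow_int ..
  finally show ?thesis .
qed

lemma a_int_b_nat:
  "bs_a [^]\<^bsub>BS12\<^esub> (x::int) \<otimes>\<^bsub>BS12\<^esub> bs_b [^]\<^bsub>BS12\<^esub> (n::nat)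
    = bs_b [^]\<^bsub>BS12\<^esub> n \<otimes>\<^bsub>BS12\<^esub> bs_a [^]\<^bsub>BS12\<^esub> (2 ^ n * x)"
proof (induction n)
  case 0
  then show ?case by (simp add: bs_a_carrier)
next
  case (Suc n)
  note c = bs_a_carrier bs_b_carrier
  have "bs_a [^]\<^bsub>BS12\<^esub> x \<otimes>\<^bsub>BS12\<^esub> bs_b [^]\<^bsub>BS12\<^esub> Suc n
      = (bs_a [^]\<^bsub>BS12\<^esub> x \<otimes>\<^bsub>BS12\<^esub> bs_b [^]\<^bsub>BS12\<^esub> n) \<otimes>\<^bsub>BS12\<^esub> bs_b"
    by (simp add: c BS.m_assoc)
  also have "\<dots> = bs_b [^]\<^bsub>BS12\<^esub> n \<otimes>\<^bsub>BS12\<^esub> (bs_a [^]\<^bsub>BS12\<^esub> (2 ^ n * x) \<otimes>\<^bsub>BS12\<^esub> bs_b)"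
    unfolding Suc by (simp add: c BS.m_assoc)
  also have "\<dots> = bs_b [^]\<^bsub>BS12\<^esub> Suc n \<otimes>\<^bsub>BS12\<^esub> bs_a [^]\<^bsub>BS12\<^esub> (2 ^ Suc n * x)"
    unfolding a_int_b by (simp add: c BS.m_assoc mult.assoc)
  finally show ?case .
qed

lemma bs_elem_mult: "bs_elem p \<otimes>\<^bsub>BS12\<^esub> bs_elem q = bs_elem (bmul p q)"
proof -
  note c = bs_a_carrier bs_b_carrier
  let ?b = "\<lambda>n::nat. bs_b [^]\<^bsub>BS12\<^esub> n" and ?a = "\<lambda>x::int. bs_a [^]\<^bsub>BS12\<^esub> x"
  have "bs_elem p \<otimes>\<^bsub>BS12\<^esub> bs_elem q
      = ?b (fst p) \<otimes>\<^bsub>BS12\<^esub> (?a (snd p) \<otimes>\<^bsub>BS12\<^esub> ?b (fst q)) \<otimes>\<^bsub>BS12\<^esub> ?a (snd q)"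
    by (simp add: bs_elem_def c BS.m_assoc)
  also have "\<dots> = (?b (fst p) \<otimes>\<^bsub>BS12\<^esub> ?b (fst q)) \<otimes>\<^bsub>BS12\<^esub> (?a (2 ^ fst q * snd p) \<otimes>\<^bsub>BS12\<^esub> ?a (snd q))"
    unfolding a_int_b_nat by (simp add: c BS.m_assoc)
  also have "\<dots> = bs_elem (bmul p q)"
    by (simp add: bs_elem_def bmul_def BS.nat_pow_mult BS.int_pow_mult c)
  finally show ?thesis .
qed

lemma BS12_plus_eq: "BS12_plus = range bs_elem"
proof
  show "BS12_plus \<subseteq> range bs_elem"
  proof
    fix X assume "X \<in> BS12_plus"
    then obtain m x :: int where "m \<ge> 0" "X = bs_b [^]\<^bsub>BS12\<^esub> m \<otimes>\<^bsub>BS12\<^esub> bs_a [^]\<^bsub>BS12\<^esub> x"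
      by (auto simp: BS12_plus_def)
    then have "X = bs_elem (nat m, x)" by (simp add: bs_elem_def flip: int_pow_int)
    then show "X \<in> range bs_elem" by blast
  qed
  show "range bs_elem \<subseteq> BS12_plus"
    unfolding BS12_plus_def bs_elem_def by (auto simp flip: int_pow_int intro: exI[of _ "int _"])
qed

lemma (in group) comm_group_subgroup_generated:
  assumes S: "S \<subseteq> carrier G" and comm: "\<And>x y. x \<in> S \<Longrightarrow> y \<in> S \<Longrightarrow> x \<otimes> y = y \<otimes> x"
  shows "comm_group (subgroup_generated G S)"
proof -
  interpret H: group "subgroup_generated G S" by (rule group_subgroup_generated)
  have gc: "x \<in> carrier G" if "x \<in> generate G S" for x
    using generate_in_carrier[OF S that] .
  have inv_comm: "inv x \<otimes> y = y \<otimes> inv x" if "x \<in> carrier G" "y \<in> carrier G" "x \<otimes> y = y \<otimes> x" for x y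
  proof -
    have "inv x \<otimes> y = inv x \<otimes> (y \<otimes> x) \<otimes> inv x" using that(1,2) by (simp add: m_assoc)
    also have "\<dots> = y \<otimes> inv x" unfolding that(3)[symmetric] using that(1,2) by (simp add: m_assoc[symmetric])
    finally show ?thesis .
  qed
  \<comment> \<open>Centralizing the generators implies centralizing the generated subgroup. It is
    used twice: first for \<open>z\<close> a generator, then for \<open>z\<close> an arbitrary
    element of the subgroup.\<close>
  have step: "y \<otimes> z = z \<otimes> y" if z: "z \<in> carrier G" "\<And>s. s \<in> S \<Longrightarrow> s \<otimes> z = z \<otimes> s" and y: "y \<in> generate G S" for y z
    using y
  proof (induction rule: generate.induct)
    case one
    then show ?case using z by simp
  next
    case (incl h)
    then show ?case using z by blast
  next
    case (inv h)
    then show ?case using z S inv_comm by blast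
  next
    case (eng h1 h2)
    have c: "h1 \<in> carrier G" "h2 \<in> carrier G" using eng gc by auto
    have "h1 \<otimes> h2 \<otimes> z = h1 \<otimes> (z \<otimes> h2)" using c z eng by (simp add: m_assoc)
    also have "\<dots> = z \<otimes> (h1 \<otimes> h2)" using c z eng(3) by (simp add: m_assoc[symmetric])
    finally show ?case .
  qed
  have "x \<otimes> y = y \<otimes> x" if "x \<in> generate G S" "y \<in> generate G S" for x y
  proof (rule step[OF gc[OF that(2)] _ that(1)])
    fix s assume s: "s \<in> S"
    have "y \<otimes> s = s \<otimes> y" by (rule step[OF _ _ that(2)]) (use s S comm in auto)
    then show "s \<otimes> y = y \<otimes> s" by simp
  qed
  moreover have "carrier (subgroup_generated G S) = generate G S"
    using S by (simp add: carrier_subgroup_generated Int_absorb1)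
  ultimately show ?thesis by (intro H.group_comm_groupI) simp
qed

theorem theorem7:
  fixes S :: "bs_gen word set set" and k :: nat
  assumes "finite S"
    and "S \<subseteq> BS12_plus"
    and "non_abelian_subset BS12 S"
    and "card S = k"
  shows "int (card (S <#>\<^bsub>BS12\<^esub> S)) \<ge> 3 * int k - 2 \<and>
    (\<forall>h::int. int (card (S <#>\<^bsub>BS12\<^esub> S)) = (3 * int k - 2) + h \<and>
        real_of_int ((3 * int k - 2) + h) < 3.5 * real k - 4 \<longrightarrow>
      (\<exists>A::int set. finite A \<and> S = ba_set A \<and>
        (\<exists>P n. arith_progression P n \<and> A \<subseteq> P \<and> int n = int k + h \<and>
          real n < 1.5 * real k - 2)))"
proof -
  define Q where "Q = bs_elem -` S"
  have S: "S = bs_elem ` Q" using assms(2) by (auto simp: Q_def BS12_plus_eq)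
  have inj: "inj_on bs_elem Y" for Y using inj_bs_elem inj_on_subset by blast
  have fin: "finite Q" unfolding Q_def using assms(1) inj_bs_elem by (rule finite_vimageI)
  have k: "card Q = k" using assms(4) card_image[OF inj, of Q] S by simp
  have "S <#>\<^bsub>BS12\<^esub> S = bs_elem ` bprod Q Q"
    unfolding set_mult_def bprod_def S by (auto simp: bs_elem_mult image_iff) blast+
  then have SS: "card (S <#>\<^bsub>BS12\<^esub> S) = card (bprod Q Q)" using card_image[OF inj] by metis
  obtain p q where pq: "p \<in> Q" "q \<in> Q" "q \<notin> cen p"
  proof (rule ccontr)
    assume neg: "\<not> thesis"
    have "x \<otimes>\<^bsub>BS12\<^esub> y = y \<otimes>\<^bsub>BS12\<^esub> x" if "x \<in> S" "y \<in> S" for x y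
    proof -
      obtain p q where pq: "p \<in> Q" "x = bs_elem p" "q \<in> Q" "y = bs_elem q" using \<open>x \<in> S\<close> \<open>y \<in> S\<close> S by blast
      then have "q \<in> cen p" using neg \<open>\<And>q p. \<lbrakk>p \<in> Q; q \<in> Q; q \<notin> cen p\<rbrakk> \<Longrightarrow> thesis\<close> by blast
      then show ?thesis using pq by (simp add: bs_elem_mult cen_def)
    qed
    moreover have "S \<subseteq> carrier BS12" using S bs_elem_carrier by blast
    ultimately have "comm_group (subgroup_generated BS12 S)"
      using BS.comm_group_subgroup_generated by blast
    then show False using assms(3) by (simp add: non_abelian_subset_def)
  qed
  have lower: "3 * k \<le> card (bprod Q Q) + 2" using card_bprod_nonabelian(1)[OF fin pq] k by simp
  have "\<exists>A. finite A \<and> S = ba_set A \<and> (\<exists>P n. arith_progression P n \<and> A \<subseteq> P \<and> int n = int k + h \<and>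
          real n < 1.5 * real k - 2)"
    if h: "int (card (bprod Q Q)) = (3 * int k - 2) + h" "real_of_int ((3 * int k - 2) + h) < 3.5 * real k - 4" for h
  proof -
    have "real (card (bprod Q Q)) < 3.5 * real k - 4" using h by (metis of_int_of_nat_eq)
    then have small: "2 * card (bprod Q Q) + 8 < 7 * card Q" using k by simp
    obtain A where A: "finite A" "Q = Pair 1 ` A" "card (bprod Q Q) = card (A + (*) 2 ` A)"
      using card_bprod_nonabelian(2)[OF fin pq small] by blast
    have cA: "card A = k" using A(2) k card_Pair_image by metis
    \<comment> \<open>Combining \<open>3k \<le> s + 2\<close> with \<open>2s + 8 < 7k\<close>, for
      \<open>s\<close> the size of the square, even gives \<open>k > 4\<close>.\<close>
    have "card A \<ge> 2" using small lower cA k by linarith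
    then obtain P where P: "arith_progression P (card (A + (*) 2 ` A) + 2 - 2 * card A)" "A \<subseteq> P"
      using card_sum_dilate_2_small[OF A(1)] small A(3) cA k by metis
    define n where "n = card (A + (*) 2 ` A) + 2 - 2 * card A"
    have n: "int n = int k + h" using h(1) A(3) cA lower by (simp add: n_def)
    have "real n = real k + of_int h" using n by (metis of_int_add of_int_of_nat_eq)
    \<comment> \<open>The bound on \<open>3k - 2 + h\<close> reduces to \<open>h < k/2 - 2\<close>,
      and \<open>n = k + h\<close>.\<close>
    then have "real n < 1.5 * real k - 2" using h(2) by simp
    moreover have "S = ba_set A"
      unfolding S A(2) ba_set_def by (auto simp: bs_elem_def bs_b_carrier image_iff)
    ultimately show ?thesis using A(1) P n unfolding n_def by blast
  qed
  then show ?thesis using lower unfolding SS by auto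
qed

end
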